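(* Let $p\geq 1$, let $\Gamma$ be a countable simplicial graph with vertex set $V\Gamma$, and let $\mathfrak{G}=\{G_v\mid v\in V\Gamma\}$ be a collection of discrete groups. Then the graph product $G=\Gamma\mathfrak{G}$ admits a proper affine isometric action on an $L_p$-space if and only if, for every $v\in V\Gamma$, the group $G_v$ admits a proper affine isometric action on an $L_p$-space.
   Context: A simplicial graph is a graph without loops or multiple edges; an edge is a 2-element subset of the vertex set. The graph product $\Gamma\mathfrak{G}$ of a collection of groups $\mathfrak{G}=\{G_v\mid v\in V\Gamma\}$ with respect to $\Gamma$ is the group obtained from the free product of the $G_v$, $v\in V\Gamma$, by adding the relations $[g_v,g_u]=1$ for all $g_v\in G_v$, $g_u\in G_u$ such that $\{v,u\}$ is an edge of $\Gamma$. It is regarded as a discrete group. An $L_p$-space is a space $L_p(\Omega,\mu)$ for some measure space $(\Omega,\mu)$ (different groups may act on different $L_p$-spaces, with the same $p$). An affine isometric action of a discrete group $H$ on a normed vector space $(\mathcal{V},\|\cdot\|)$ is a pair $(\pi,b)$ where $\pi\colon H\to \mathrm{GL}(\mathcal{V})$ is a homomorphism with $\|\pi(g)v\|=\|v\|$ for all $g\in H$, $v\in\mathcal{V}$, and $b\colon H\to\mathcal{V}$ is a 1-cocycle, i.e. $b(gh)=\pi(g)b(h)+b(g)$ for all $g,h\in H$; the element $g$ acts by $v\mapsto \pi(g)v+b(g)$. The action is proper if for every $M>0$ and every $v\in\mathcal{V}$ there is a finite subset $F\subseteq H$ such that $\|\pi(g)v+b(g)\|>M$ for all $g\in H\setminus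 F$; equivalently, for every $M>0$ there is a finite $F\subseteq H$ with $\|b(g)\|>M$ for all $g\in H\setminus F$. *)

theory Defs
  imports
    "HOL-Analysis.Analysis"
    "HOL-Algebra.Group"
    "HOL-Algebra.Bij"
    "HOL-Library.Infinite_Typeclass"
begin

section \<open>Graph products of groups\<close>

definition simplicial_graph :: "'v set \<Rightarrow> 'v set set \<Rightarrow> bool" where
  "simplicial_graph V E \<longleftrightarrow> (\<forall>e\<in>E. e \<subseteq> V \<and> card e = 2)"

definition syllable_words :: "'v set \<Rightarrow> ('v \<Rightarrow> 'a monoid) \<Rightarrow> ('v \<times> 'a) list set" where
  "syllable_words V G = lists (SIGMA v:V. carrier (G v))"

text \<open>
  The congruence on words with letters in the disjoint union of the groups \<open>G v\<close>, \<open>v \<in> V\<close>, that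
  presents the free product of the \<open>G v\<close> with the additional relations \<open>r = 1\<close> for \<open>r \<in> R\<close>.
  The rules \<open>unit\<close> and \<open>mult\<close> alone (that is, \<open>R = {}\<close>) define the free product.
\<close>

inductive free_product_cong ::
    "'v set \<Rightarrow> ('v \<Rightarrow> 'a monoid) \<Rightarrow> ('v \<times> 'a) list set \<Rightarrow> ('v \<times> 'a) list \<Rightarrow> ('v \<times> 'a) list \<Rightarrow> bool"
  for V G R where
  refl: "w \<in> syllable_words V G \<Longrightarrow> free_product_cong V G R w w"
| sym: "free_product_cong V G R w w' \<Longrightarrow> free_product_cong V G R w' w"
| trans: "free_product_cong V G R w w' \<Longrightarrow> free_product_cong V G R w' w'' \<Longrightarrow>
    free_product_cong V G R w w''"
| subword: "free_product_cong V G R w w' \<Longrightarrow> x \<in> syllable_words V G \<Longrightarrow> y \<in> syllable_words V G \<Longrightarrow>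
    free_product_cong V G R (x @ w @ y) (x @ w' @ y)"
| unit: "v \<in> V \<Longrightarrow> free_product_cong V G R [(v, \<one>\<^bsub>G v\<^esub>)] []"
| mult: "v \<in> V \<Longrightarrow> g \<in> carrier (G v) \<Longrightarrow> h \<in> carrier (G v) \<Longrightarrow>
    free_product_cong V G R [(v, g), (v, h)] [(v, g \<otimes>\<^bsub>G v\<^esub> h)]"
| relator: "r \<in> R \<Longrightarrow> r \<in> syllable_words V G \<Longrightarrow> free_product_cong V G R r []"

definition free_product_rel ::
    "'v set \<Rightarrow> ('v \<Rightarrow> 'a monoid) \<Rightarrow> ('v \<times> 'a) list set \<Rightarrow> (('v \<times> 'a) list \<times> ('v \<times> 'a) list) set" where
  "free_product_rel V G R = {(w, w'). free_product_cong V G R w w'}"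

definition free_product_with_relators ::
    "'v set \<Rightarrow> ('v \<Rightarrow> 'a monoid) \<Rightarrow> ('v \<times> 'a) list set \<Rightarrow> ('v \<times> 'a) list set monoid" where
  "free_product_with_relators V G R =
    \<lparr>carrier = syllable_words V G // free_product_rel V G R,
     mult = (\<lambda>X Y. \<Union>x\<in>X. \<Union>y\<in>Y. free_product_rel V G R `` {x @ y}),
     one = free_product_rel V G R `` {[]}\<rparr>"

definition graph_product_relators ::
    "'v set set \<Rightarrow> ('v \<Rightarrow> 'a monoid) \<Rightarrow> ('v \<times> 'a) list set" where
  "graph_product_relators E G =
    {[(v, g), (u, h), (v, inv\<^bsub>G v\<^esub> g), (u, inv\<^bsub>G u\<^esub> h)] | v u g h.
       {v, u} \<in> E \<and> g \<in> carrier (G v) \<and> h \<in> carrier (G u)}"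

definition graph_product ::
    "'v set \<Rightarrow> 'v set set \<Rightarrow> ('v \<Rightarrow> 'a monoid) \<Rightarrow> ('v \<times> 'a) list set monoid" where
  "graph_product V E G = free_product_with_relators V G (graph_product_relators E G)"

lemma free_product_cong_words:
  assumes "\<forall>v\<in>V. group (G v)" "free_product_cong V G R w w'"
  shows "w \<in> syllable_words V G \<and> w' \<in> syllable_words V G"
  using assms(2,1)
  by induction (simp_all add: syllable_words_def group.is_monoid monoid.one_closed monoid.m_closed)

lemma equiv_free_product_rel:
  assumes G: "\<forall>v\<in>V. group (G v)"
  shows "equiv (syllable_words V G) (free_product_rel V G R)"
proof (intro equivI refl_onI symI transI)
  show "free_product_rel V G R \<subseteq> syllable_words V G \<times> syllable_words V G"
    using free_product_cong_words[OF G] by (auto simp: free_product_rel_def)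
qed (simp_all add: free_product_rel_def free_product_cong.refl free_product_cong.sym,
    rule free_product_cong.trans)

lemma free_product_cong_append:
  assumes G: "\<forall>v\<in>V. group (G v)"
    and "free_product_cong V G R w w'" "free_product_cong V G R x x'"
  shows "free_product_cong V G R (w @ x) (w' @ x')"
proof -
  have "free_product_cong V G R ([] @ w @ x) ([] @ w' @ x)"
    using assms free_product_cong_words[OF G]
    by (intro free_product_cong.subword) (auto simp: syllable_words_def)
  moreover have "free_product_cong V G R (w' @ x @ []) (w' @ x' @ [])"
    using assms free_product_cong_words[OF G]
    by (intro free_product_cong.subword) (auto simp: syllable_words_def)
  ultimately show ?thesis
    using free_product_cong.trans[of V G R "w @ x" "w' @ x" "w' @ x'"] by simp
qed

lemma free_product_mult_class:
  assumes G: "\<forall>v\<in>V. group (G v)"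
    and "x \<in> syllable_words V G" "y \<in> syllable_words V G"
  shows "(free_product_rel V G R `` {x}) \<otimes>\<^bsub>free_product_with_relators V G R\<^esub>
    (free_product_rel V G R `` {y}) = free_product_rel V G R `` {x @ y}"
proof -
  let ?r = "free_product_rel V G R"
  have "(\<lambda>x y. ?r `` {x @ y}) respects2 ?r"
    by (intro congruent2I' equiv_class_eq[OF equiv_free_product_rel[OF G]])
      (simp add: free_product_rel_def free_product_cong_append[OF G])
  from UN_equiv_class2[OF equiv_free_product_rel[OF G] equiv_free_product_rel[OF G] this assms(2,3)]
  show ?thesis
    by (simp add: free_product_with_relators_def)
qed

lemma free_product_cong_inverse:
  assumes G: "\<forall>v\<in>V. group (G v)" and "w \<in> syllable_words V G"
  shows "\<exists>w'\<in>syllable_words V G. free_product_cong V G R (w' @ w) []"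
  using assms(2)
proof (induction w)
  case Nil
  then show ?case by (auto intro!: bexI[of _ "[]"] free_product_cong.refl)
next
  case (Cons a w)
  obtain v g where a: "a = (v, g)" "v \<in> V" "g \<in> carrier (G v)"
    using Cons.prems by (auto simp: syllable_words_def)
  have w: "w \<in> syllable_words V G" using Cons.prems by (auto simp: syllable_words_def)
  obtain w' where w': "w' \<in> syllable_words V G" "free_product_cong V G R (w' @ w) []"
    using Cons.IH w by auto
  interpret group "G v" using G a by auto
  let ?i = "(v, inv\<^bsub>G v\<^esub> g)"
  have "free_product_cong V G R [?i, a] [(v, \<one>\<^bsub>G v\<^esub>)]"
    using free_product_cong.mult[of v V "inv\<^bsub>G v\<^esub> g" G g R] a by simp
  then have "free_product_cong V G R [?i, a] []"
    using free_product_cong.unit[OF a(2)] free_product_cong.trans by metis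
  from free_product_cong.subword[OF this w'(1) w]
  have "free_product_cong V G R ((w' @ [?i]) @ a # w) (w' @ w)" by simp
  with w' have "free_product_cong V G R ((w' @ [?i]) @ a # w) []"
    using free_product_cong.trans by metis
  moreover have "w' @ [?i] \<in> syllable_words V G"
    using w' a by (auto simp: syllable_words_def)
  ultimately show ?case by metis
qed

lemma group_free_product_with_relators:
  assumes G: "\<forall>v\<in>V. group (G v)"
  shows "group (free_product_with_relators V G R)" (is "group ?F")
proof -
  let ?r = "free_product_rel V G R"
  have carrier: "carrier ?F = syllable_words V G // ?r"
    and one: "\<one>\<^bsub>?F\<^esub> = ?r `` {[]}"
    by (simp_all add: free_product_with_relators_def)
  have app: "x @ y \<in> syllable_words V G"
    if "x \<in> syllable_words V G" "y \<in> syllable_words V G" for x y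
    using that by (auto simp: syllable_words_def)
  have nil: "[] \<in> syllable_words V G" by (simp add: syllable_words_def)
  note mult = free_product_mult_class[OF G, of _ _ R]
  show ?thesis
  proof (rule groupI)
    show "\<exists>Y\<in>carrier ?F. Y \<otimes>\<^bsub>?F\<^esub> X = \<one>\<^bsub>?F\<^esub>" if X: "X \<in> carrier ?F" for X
    proof -
      obtain x where x: "x \<in> syllable_words V G" "X = ?r `` {x}"
        using X unfolding carrier by (rule quotientE)
      obtain y where y: "y \<in> syllable_words V G" "free_product_cong V G R (y @ x) []"
        using free_product_cong_inverse[OF G x(1)] by blast
      have "?r `` {y @ x} = ?r `` {[]}"
        by (rule equiv_class_eq[OF equiv_free_product_rel[OF G]]) (simp add: free_product_rel_def y)
      then have "?r `` {y} \<otimes>\<^bsub>?F\<^esub> X = \<one>\<^bsub>?F\<^esub>"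
        by (simp add: x mult y one)
      then show ?thesis
        unfolding carrier using quotientI[OF y(1)] by (rule bexI)
    qed
  next
    show "\<one>\<^bsub>?F\<^esub> \<in> carrier ?F"
      using nil by (simp add: carrier one quotientI)
  next
    show "X \<otimes>\<^bsub>?F\<^esub> Y \<in> carrier ?F" if XY: "X \<in> carrier ?F" "Y \<in> carrier ?F" for X Y
      using XY unfolding carrier by (elim quotientE) (simp add: mult app quotientI)
  next
    show "X \<otimes>\<^bsub>?F\<^esub> Y \<otimes>\<^bsub>?F\<^esub> Z = X \<otimes>\<^bsub>?F\<^esub> (Y \<otimes>\<^bsub>?F\<^esub> Z)"
      if XYZ: "X \<in> carrier ?F" "Y \<in> carrier ?F" "Z \<in> carrier ?F" for X Y Z
      using XYZ unfolding carrier by (elim quotientE) (simp add: mult app)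
  next
    show "\<one>\<^bsub>?F\<^esub> \<otimes>\<^bsub>?F\<^esub> X = X" if X: "X \<in> carrier ?F" for X
      using X unfolding carrier by (elim quotientE) (simp add: one mult nil)
  qed
qed


section \<open>Affine isometric actions on normed vector spaces\<close>

text \<open>Since \<open>L\<^sub>p\<close>-spaces depend on a measure, normed spaces are given by explicit carriers.\<close>

record ('k, 'e) normed_space =
  vectors :: "'e set"
  vadd :: "'e \<Rightarrow> 'e \<Rightarrow> 'e"
  vscale :: "'k \<Rightarrow> 'e \<Rightarrow> 'e"
  vnorm :: "'e \<Rightarrow> real"

text \<open>\<open>BijGroup S\<close> is the group of bijections of \<open>S\<close>, undefined outside \<open>S\<close>, under composition.\<close>

definition GL :: "('k, 'e) normed_space \<Rightarrow> ('e \<Rightarrow> 'e) monoid" where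
  "GL X = (BijGroup (vectors X))
    \<lparr>carrier := {T \<in> Bij (vectors X).
       (\<forall>x\<in>vectors X. \<forall>y\<in>vectors X. T (vadd X x y) = vadd X (T x) (T y)) \<and>
       (\<forall>c. \<forall>x\<in>vectors X. T (vscale X c x) = vscale X c (T x))}\<rparr>"

definition affine_isometric_action ::
    "'h monoid \<Rightarrow> ('k, 'e) normed_space \<Rightarrow> ('h \<Rightarrow> 'e \<Rightarrow> 'e) \<Rightarrow> ('h \<Rightarrow> 'e) \<Rightarrow> bool" where
  "affine_isometric_action H X \<pi> b \<longleftrightarrow>
    \<pi> \<in> hom H (GL X) \<and>
    (\<forall>g\<in>carrier H. \<forall>x\<in>vectors X. vnorm X (\<pi> g x) = vnorm X x) \<and>
    b \<in> carrier H \<rightarrow> vectors X \<and>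
    (\<forall>g\<in>carrier H. \<forall>h\<in>carrier H. b (g \<otimes>\<^bsub>H\<^esub> h) = vadd X (\<pi> g (b h)) (b g))"

definition proper_action ::
    "'h monoid \<Rightarrow> ('k, 'e) normed_space \<Rightarrow> ('h \<Rightarrow> 'e \<Rightarrow> 'e) \<Rightarrow> ('h \<Rightarrow> 'e) \<Rightarrow> bool" where
  "proper_action H X \<pi> b \<longleftrightarrow>
    (\<forall>M>0. \<forall>x\<in>vectors X. \<exists>F. finite F \<and> F \<subseteq> carrier H \<and>
       (\<forall>g\<in>carrier H - F. vnorm X (vadd X (\<pi> g x) (b g)) > M))"


section \<open>\<open>L\<^sub>p\<close>-spaces\<close>

text \<open>
  Scalars range over \<open>'k\<close>; by the Gelfand-Mazur theorem the only fields in the class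
  \<^class>\<open>real_normed_field\<close> are, up to isomorphism, the real and the complex numbers.
\<close>

definition Lp_functions ::
    "real \<Rightarrow> 'o measure \<Rightarrow> ('o \<Rightarrow> 'k::{real_normed_field, second_countable_topology}) set" where
  "Lp_functions p M = {f \<in> borel_measurable M. integrable M (\<lambda>x. norm (f x) powr p)}"

definition Lp_rel ::
    "real \<Rightarrow> 'o measure \<Rightarrow>
     (('o \<Rightarrow> 'k::{real_normed_field, second_countable_topology}) \<times> ('o \<Rightarrow> 'k)) set" where
  "Lp_rel p M = {(f, g). f \<in> Lp_functions p M \<and> g \<in> Lp_functions p M \<and> (AE x in M. f x = g x)}"

definition Lp ::
    "real \<Rightarrow> 'o measure \<Rightarrow>
     ('k::{real_normed_field, second_countable_topology}, ('o \<Rightarrow> 'k) set) normed_space" where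
  "Lp p M =
    \<lparr>vectors = Lp_functions p M // Lp_rel p M,
     vadd = (\<lambda>X Y. \<Union>f\<in>X. \<Union>g\<in>Y. Lp_rel p M `` {\<lambda>x. f x + g x}),
     vscale = (\<lambda>c X. \<Union>f\<in>X. Lp_rel p M `` {\<lambda>x. c * f x}),
     vnorm = (\<lambda>X. the_elem ((\<lambda>f. (\<integral>x. norm (f x) powr p \<partial>M) powr (1 / p)) ` X))\<rparr>"

text \<open>
  The underlying set of the measure space may be any subset of \<open>'o\<close>. HOL cannot quantify over
  types within a formula, so the type \<open>'o\<close> bounding its cardinality is a parameter; every measure
  space embeds into some such type. It must be infinite for the bound to be stable under countable
  disjoint unions: a one-point \<open>'o\<close> would only allow actions on spaces of dimension at most one.
\<close>

definition admits_proper_Lp_action ::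
    "'o::infinite itself \<Rightarrow> 'k::{real_normed_field, second_countable_topology} itself \<Rightarrow>
     real \<Rightarrow> 'h monoid \<Rightarrow> bool" where
  "admits_proper_Lp_action _ _ p H \<longleftrightarrow>
    (\<exists>(M :: 'o measure) \<pi> b.
       affine_isometric_action H (Lp p M :: ('k, ('o \<Rightarrow> 'k) set) normed_space) \<pi> b \<and>
       proper_action H (Lp p M :: ('k, ('o \<Rightarrow> 'k) set) normed_space) \<pi> b)"

end

theory Submission
  imports Defs
begin

text \<open>
  If the graph product acts properly, so do its subgroups, and the vertex groups are subgroups: each
  of them is a retract of the graph product.

  For the converse, the actions of the vertex groups are induced to the graph product. In geometric
  terms, the cosets of the subgroup generated by the \<open>G u\<close> with \<open>u = v\<close> or \<open>u\<close> adjacent to \<open>v\<close>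
  are the hyperplanes of type \<open>v\<close>. The graph product acts on an \<open>\<ell>\<^sub>p\<close>-sum with a summand for
  each hyperplane, a copy of the space on which \<open>G v\<close> acts. The cocycle of \<open>G v\<close>, placed at the base
  hyperplane of type \<open>v\<close>, gives an affine action of \<open>G v\<close>. Along the edges of the graph these actions
  commute, so they extend to the graph product. If \<open>g = s\<^sub>1 \<dots> s\<^sub>n\<close> is a word of minimal length,
  with \<open>s\<^sub>i\<close> in the vertex group of \<open>v\<^sub>i\<close>, then the \<open>n\<close> letters contribute at \<open>n\<close>
  different hyperplanes (\<open>geodesic_separates\<close>), so that

    \<open>\<parallel>b(g)\<parallel>\<^sup>p = \<parallel>b\<^sub>1(s\<^sub>1)\<parallel>\<^sup>p + \<dots> + \<parallel>b\<^sub>n(s\<^sub>n)\<parallel>\<^sup>p\<close>,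

  where \<open>b\<^sub>i\<close> is the cocycle of the vertex group of \<open>v\<^sub>i\<close> (\<open>norm_word_action\<close>). Suppose that
  the cocycles of the vertex groups are proper and bounded below away from the identity, by bounds
  that are at least \<open>1\<close> and of which only finitely many lie below any given number. Then a bound on \<open>\<parallel>b(g)\<parallel>\<close> leaves finitely many words, and the action
  is proper. Such lower bounds are achieved by first adding, in each vertex group, a large
  coboundary of the regular representation (\<open>ex_proper_action_bounded_below\<close>).

  Both constructions take place on countable \<open>\<ell>\<^sub>p\<close>-sums of \<open>L\<^sub>p\<close>-spaces, and these are again
  \<open>L\<^sub>p\<close>-spaces, over the disjoint union of the measure spaces (\<open>lp_sum_action_on_Lp\<close>).
\<close>


section \<open>Words in a graph product\<close>

lemma syllable_words_simps [simp]:
  "[] \<in> syllable_words V G"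
  "a # w \<in> syllable_words V G \<longleftrightarrow> fst a \<in> V \<and> snd a \<in> carrier (G (fst a)) \<and> w \<in> syllable_words V G"
  "x @ y \<in> syllable_words V G \<longleftrightarrow> x \<in> syllable_words V G \<and> y \<in> syllable_words V G"
proof -
  have "a \<in> Sigma V (\<lambda>v. carrier (G v)) \<longleftrightarrow> fst a \<in> V \<and> snd a \<in> carrier (G (fst a))"
    by (cases a) simp
  then show "a # w \<in> syllable_words V G \<longleftrightarrow>
      fst a \<in> V \<and> snd a \<in> carrier (G (fst a)) \<and> w \<in> syllable_words V G"
    by (simp add: syllable_words_def)
qed (auto simp: syllable_words_def)

lemma syllable_words_filter [simp]:
  "w \<in> syllable_words V G \<Longrightarrow> filter P w \<in> syllable_words V G"
  by (auto simp: syllable_words_def)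

locale graph_product_of_groups =
  fixes V :: "'v set" and E :: "'v set set" and G :: "'v \<Rightarrow> 'a monoid"
  assumes simplicial: "simplicial_graph V E"
    and groups: "v \<in> V \<Longrightarrow> group (G v)"
begin

abbreviation words :: "('v \<times> 'a) list set" where
  "words \<equiv> syllable_words V G"

abbreviation \<G> :: "('v \<times> 'a) list set monoid" where
  "\<G> \<equiv> graph_product V E G"

abbreviation cong_words :: "('v \<times> 'a) list \<Rightarrow> ('v \<times> 'a) list \<Rightarrow> bool" (infix "\<sim>" 50) where
  "x \<sim> y \<equiv> free_product_cong V G (graph_product_relators E G) x y"

definition cls :: "('v \<times> 'a) list \<Rightarrow> ('v \<times> 'a) list set" where
  "cls w = free_product_rel V G (graph_product_relators E G) `` {w}"

lemma groups': "\<forall>v\<in>V. group (G v)"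
  using groups by blast

lemma edgeD:
  assumes "{v, u} \<in> E"
  shows "v \<noteq> u" "v \<in> V" "u \<in> V"
proof -
  have "{v, u} \<subseteq> V" "card {v, u} = 2"
    using simplicial assms unfolding simplicial_graph_def by blast+
  then show "v \<noteq> u" "v \<in> V" "u \<in> V" by auto
qed

lemma cong_wordsD: "x \<sim> y \<Longrightarrow> x \<in> words" "x \<sim> y \<Longrightarrow> y \<in> words"
  using free_product_cong_words[OF groups'] by blast+

lemmas cong_append = free_product_cong_append[OF groups']

lemma cls_eq_iff: "x \<in> words \<Longrightarrow> y \<in> words \<Longrightarrow> cls x = cls y \<longleftrightarrow> x \<sim> y"
  unfolding cls_def
  by (subst eq_equiv_class_iff[OF equiv_free_product_rel[OF groups']])
    (auto simp: free_product_rel_def)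

lemma carrier_graph_product: "carrier \<G> = cls ` words"
  by (auto simp: graph_product_def free_product_with_relators_def quotient_def cls_def)

lemma cls_closed [simp]: "w \<in> words \<Longrightarrow> cls w \<in> carrier \<G>"
  by (simp add: carrier_graph_product)

lemma cls_append: "x \<in> words \<Longrightarrow> y \<in> words \<Longrightarrow> cls (x @ y) = cls x \<otimes>\<^bsub>\<G>\<^esub> cls y"
  unfolding cls_def graph_product_def by (rule free_product_mult_class[OF groups', symmetric])

lemma cls_Nil: "cls [] = \<one>\<^bsub>\<G>\<^esub>"
  by (simp add: cls_def graph_product_def free_product_with_relators_def)

lemma cls_Cons:
  "v \<in> V \<Longrightarrow> s \<in> carrier (G v) \<Longrightarrow> w \<in> words \<Longrightarrow> cls ((v, s) # w) = cls [(v, s)] \<otimes>\<^bsub>\<G>\<^esub> cls w"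
  using cls_append[of "[(v, s)]" w] by simp

sublocale \<G>: group \<G>
  unfolding graph_product_def by (rule group_free_product_with_relators[OF groups'])

lemma cls_unit: "v \<in> V \<Longrightarrow> cls [(v, \<one>\<^bsub>G v\<^esub>)] = \<one>\<^bsub>\<G>\<^esub>"
  unfolding cls_Nil[symmetric]
  by (subst cls_eq_iff) (auto intro: free_product_cong.unit simp: groups group.is_monoid)

lemma cls_mult:
  "v \<in> V \<Longrightarrow> g \<in> carrier (G v) \<Longrightarrow> h \<in> carrier (G v) \<Longrightarrow>
    cls [(v, g \<otimes>\<^bsub>G v\<^esub> h)] = cls [(v, g)] \<otimes>\<^bsub>\<G>\<^esub> cls [(v, h)]"
  using cls_append[of "[(v, g)]" "[(v, h)]"] free_product_cong.mult[of v V g G h]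
    cls_eq_iff cong_wordsD by (metis append_Cons append_Nil syllable_words_simps fst_conv snd_conv)

text \<open>
  A relator is a commutator, so multiplying it on the right by the two commuted letters turns it
  into the equation that lets adjacent letters pass each other.
\<close>

lemma cls_commute:
  assumes "{v, u} \<in> E" "g \<in> carrier (G v)" "h \<in> carrier (G u)"
  shows "cls [(v, g), (u, h)] = cls [(u, h), (v, g)]"
proof -
  note e = edgeD[OF assms(1)]
  interpret v: group "G v" using e groups by blast
  interpret u: group "G u" using e groups by blast
  let ?g = "cls [(v, g)]" and ?h = "cls [(u, h)]"
  let ?g' = "cls [(v, inv\<^bsub>G v\<^esub> g)]" and ?h' = "cls [(u, inv\<^bsub>G u\<^esub> h)]"
  let ?r = "[(v, g), (u, h), (v, inv\<^bsub>G v\<^esub> g), (u, inv\<^bsub>G u\<^esub> h)]"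
  have "?r \<sim> []"
    using assms e by (intro free_product_cong.relator) (auto simp: graph_product_relators_def)
  then have "cls ?r = \<one>\<^bsub>\<G>\<^esub>"
    using cls_eq_iff[of ?r "[]"] cong_wordsD[of ?r "[]"] by (simp add: cls_Nil)
  moreover have "cls ?r = ?g \<otimes>\<^bsub>\<G>\<^esub> ?h \<otimes>\<^bsub>\<G>\<^esub> ?g' \<otimes>\<^bsub>\<G>\<^esub> ?h'"
    using cls_append[of "[(v, g)]" "[(u, h)]"] cls_append[of "[(v, g), (u, h)]" "[(v, inv\<^bsub>G v\<^esub> g)]"]
      cls_append[of "[(v, g), (u, h), (v, inv\<^bsub>G v\<^esub> g)]" "[(u, inv\<^bsub>G u\<^esub> h)]"] assms e by simp
  moreover have "?g' = inv\<^bsub>\<G>\<^esub> ?g"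
    using cls_mult[of v "inv\<^bsub>G v\<^esub> g" g] assms e
    by (intro \<G>.inv_equality[symmetric]) (simp_all add: cls_unit)
  moreover have "?h' = inv\<^bsub>\<G>\<^esub> ?h"
    using cls_mult[of u "inv\<^bsub>G u\<^esub> h" h] assms e
    by (intro \<G>.inv_equality[symmetric]) (simp_all add: cls_unit)
  ultimately have "?g \<otimes>\<^bsub>\<G>\<^esub> ?h \<otimes>\<^bsub>\<G>\<^esub> inv\<^bsub>\<G>\<^esub> ?g \<otimes>\<^bsub>\<G>\<^esub> inv\<^bsub>\<G>\<^esub> ?h = \<one>\<^bsub>\<G>\<^esub>"
    by simp
  then have "?g \<otimes>\<^bsub>\<G>\<^esub> ?h = ?h \<otimes>\<^bsub>\<G>\<^esub> ?g"
    using assms e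
    by (metis \<G>.inv_solve_right' \<G>.m_closed \<G>.inv_closed \<G>.l_one \<G>.one_closed cls_closed
        syllable_words_simps(1,2) fst_conv snd_conv)
  then show ?thesis
    using cls_append[of "[(v, g)]" "[(u, h)]"] cls_append[of "[(u, h)]" "[(v, g)]"] assms e by simp
qed

text \<open>
  The universal property, for actions on a set \<open>Y\<close> instead of homomorphisms: actions of the
  \<open>G v\<close> on \<open>Y\<close> that commute along edges fit together to an action of the graph product.
  A homomorphism to a group \<open>Q\<close> is the case of the translations of \<open>Y = carrier Q\<close>.
\<close>

lemma syllable_action_cong:
  fixes F :: "'v \<Rightarrow> 'a \<Rightarrow> 'y \<Rightarrow> 'y"
  assumes closed: "\<And>v g y. v \<in> V \<Longrightarrow> g \<in> carrier (G v) \<Longrightarrow> y \<in> Y \<Longrightarrow> F v g y \<in> Y"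
    and unit: "\<And>v y. v \<in> V \<Longrightarrow> y \<in> Y \<Longrightarrow> F v \<one>\<^bsub>G v\<^esub> y = y"
    and mult: "\<And>v g h y. v \<in> V \<Longrightarrow> g \<in> carrier (G v) \<Longrightarrow> h \<in> carrier (G v) \<Longrightarrow> y \<in> Y \<Longrightarrow>
      F v (g \<otimes>\<^bsub>G v\<^esub> h) y = F v g (F v h y)"
    and commute: "\<And>v u g h y. {v, u} \<in> E \<Longrightarrow> g \<in> carrier (G v) \<Longrightarrow> h \<in> carrier (G u) \<Longrightarrow> y \<in> Y \<Longrightarrow>
      F v g (F u h y) = F u h (F v g y)"
    and cong: "w \<sim> w'" and y: "y \<in> Y"
  shows "foldr (\<lambda>(v, g). F v g) w y = foldr (\<lambda>(v, g). F v g) w' y"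
proof -
  have fold_closed: "foldr (\<lambda>(v, g). F v g) x y \<in> Y" if "x \<in> words" "y \<in> Y" for x y
    using that by (induction x) (auto intro: closed)
  show ?thesis
    using cong y
  proof (induction arbitrary: y)
    case (relator r)
    then obtain v u g h where r: "r = [(v, g), (u, h), (v, inv\<^bsub>G v\<^esub> g), (u, inv\<^bsub>G u\<^esub> h)]"
      and e: "{v, u} \<in> E" and gh: "g \<in> carrier (G v)" "h \<in> carrier (G u)"
      by (auto simp: graph_product_relators_def)
    note e' = edgeD[OF e]
    interpret v: group "G v" using e' groups by blast
    interpret u: group "G u" using e' groups by blast
    have inv: "F v g (F v (inv\<^bsub>G v\<^esub> g) z) = z" "F u h (F u (inv\<^bsub>G u\<^esub> h) z) = z" if "z \<in> Y" for z
      using mult[of v g "inv\<^bsub>G v\<^esub> g" z] mult[of u h "inv\<^bsub>G u\<^esub> h" z] gh e' that by (auto simp: unit)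
    have "F v g (F u h (F v (inv\<^bsub>G v\<^esub> g) (F u (inv\<^bsub>G u\<^esub> h) y)))
        = F u h (F v g (F v (inv\<^bsub>G v\<^esub> g) (F u (inv\<^bsub>G u\<^esub> h) y)))"
      using gh e e' relator.prems by (intro commute closed) auto
    also have "\<dots> = y"
      using gh e' relator.prems by (simp add: inv closed)
    finally show ?case by (simp add: r)
  qed (simp_all add: fold_closed unit mult cong_wordsD)
qed

lemma cong_words_filter:
  assumes "x \<sim> y"
  shows "filter (\<lambda>a. fst a \<in> S) x \<sim> filter (\<lambda>a. fst a \<in> S) y"
  using assms
proof induction
  case (trans w w' w'')
  then show ?case using free_product_cong.trans by metis
next
  case (unit v)
  then show ?case
    by (auto intro: free_product_cong.refl free_product_cong.unit)
next
  case (mult v g h)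
  then show ?case
    by (auto intro: free_product_cong.refl free_product_cong.mult)
next
  case (relator r)
  then obtain v u g h where r: "r = [(v, g), (u, h), (v, inv\<^bsub>G v\<^esub> g), (u, inv\<^bsub>G u\<^esub> h)]"
    and e: "{v, u} \<in> E" and gh: "g \<in> carrier (G v)" "h \<in> carrier (G u)"
    by (auto simp: graph_product_relators_def)
  have cancel: "[(x, k), (x, inv\<^bsub>G x\<^esub> k)] \<sim> []" if "x \<in> V" "k \<in> carrier (G x)" for x k
  proof -
    interpret group "G x" using groups that by blast
    show ?thesis
      using that cls_mult[of x k "inv\<^bsub>G x\<^esub> k"] cls_append[of "[(x, k)]" "[(x, inv\<^bsub>G x\<^esub> k)]"]
        cls_eq_iff[of "[(x, k), (x, inv\<^bsub>G x\<^esub> k)]" "[]"] by (simp add: cls_unit cls_Nil)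
  qed
  show ?case
    using relator r cancel[of v g] cancel[of u h] edgeD[OF e] gh
    by (auto intro: free_product_cong.relator free_product_cong.refl)
qed (auto intro: free_product_cong.refl free_product_cong.sym free_product_cong.subword)

text \<open>
  The retraction of the graph product onto the subgroup generated by the \<open>G v\<close> with \<open>v \<in> S\<close>, which
  kills the other vertex groups.
\<close>

definition restriction :: "'v set \<Rightarrow> ('v \<times> 'a) list set \<Rightarrow> ('v \<times> 'a) list set" where
  "restriction S g = cls (filter (\<lambda>a. fst a \<in> S) (SOME w. w \<in> words \<and> cls w = g))"

lemma restriction_cls:
  assumes "w \<in> words"
  shows "restriction S (cls w) = cls (filter (\<lambda>a. fst a \<in> S) w)"
proof -
  let ?w = "SOME x. x \<in> words \<and> cls x = cls w"
  have "?w \<in> words \<and> cls ?w = cls w"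
    by (rule someI[of _ w]) (use assms in simp)
  then have "?w \<sim> w" using cls_eq_iff assms by blast
  from cong_words_filter[OF this, of S] show ?thesis
    unfolding restriction_def by (subst cls_eq_iff) (auto dest: cong_wordsD)
qed

lemma restriction_hom: "restriction S \<in> hom \<G> \<G>"
  by (auto simp: hom_def carrier_graph_product restriction_cls simp flip: cls_append)

text \<open>
  The retraction of the graph product onto \<open>G v\<close>, with values in \<open>G v\<close> itself: it multiplies the
  letters of type \<open>v\<close>.
\<close>

definition component :: "'v \<Rightarrow> ('v \<times> 'a) list set \<Rightarrow> 'a" where
  "component v g = foldr (\<lambda>(u, s) x. if u = v then s \<otimes>\<^bsub>G v\<^esub> x else x)
     (SOME w. w \<in> words \<and> cls w = g) \<one>\<^bsub>G v\<^esub>"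

lemma component_cls:
  assumes "v \<in> V" "w \<in> words"
  shows "component v (cls w) = foldr (\<lambda>(u, s) x. if u = v then s \<otimes>\<^bsub>G v\<^esub> x else x) w \<one>\<^bsub>G v\<^esub>"
proof -
  interpret group "G v" using groups assms by blast
  let ?w = "SOME x. x \<in> words \<and> cls x = cls w"
  have "?w \<in> words \<and> cls ?w = cls w"
    by (rule someI[of _ w]) (use assms in simp)
  then have "?w \<sim> w" using cls_eq_iff assms by blast
  then show ?thesis
    unfolding component_def
    by (intro syllable_action_cong[where Y = "carrier (G v)"]) (auto simp: m_assoc dest: edgeD)
qed

lemma component_hom:
  assumes "v \<in> V"
  shows "component v \<in> hom \<G> (G v)"
proof -
  interpret group "G v" using groups assms by blast
  let ?f = "\<lambda>(u, s) x. if u = v then s \<otimes>\<^bsub>G v\<^esub> x else x"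
  have closed: "foldr ?f w x \<in> carrier (G v)" if "w \<in> words" "x \<in> carrier (G v)" for w x
    using that by (induction w) auto
  have split: "foldr ?f w x = foldr ?f w \<one>\<^bsub>G v\<^esub> \<otimes>\<^bsub>G v\<^esub> x" if "w \<in> words" "x \<in> carrier (G v)" for w x
    using that by (induction w) (auto simp: m_assoc closed)
  have "foldr ?f (x @ y) \<one>\<^bsub>G v\<^esub> = foldr ?f x \<one>\<^bsub>G v\<^esub> \<otimes>\<^bsub>G v\<^esub> foldr ?f y \<one>\<^bsub>G v\<^esub>"
    if "x \<in> words" "y \<in> words" for x y
    using split[OF that(1) closed[OF that(2) one_closed]] by simp
  then show ?thesis
    using assms closed by (auto simp: hom_def carrier_graph_product component_cls simp flip: cls_append)
qed

lemma component_letter: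
  assumes "v \<in> V" "u \<in> V" "s \<in> carrier (G u)"
  shows "component v (cls [(u, s)]) = (if u = v then s else \<one>\<^bsub>G v\<^esub>)"
proof -
  interpret group "G v" using groups assms by blast
  show ?thesis using assms by (auto simp: component_cls)
qed

text \<open>
  The retraction \<open>component v\<close> shows that the vertex groups embed, without any normal form.
\<close>

lemma inj_on_letter: "v \<in> V \<Longrightarrow> inj_on (\<lambda>s. cls [(v, s)]) (carrier (G v))"
  by (rule inj_on_inverseI[of _ "component v"]) (simp add: component_letter)

lemma letter_hom: "v \<in> V \<Longrightarrow> (\<lambda>s. cls [(v, s)]) \<in> hom (G v) \<G>"
  by (auto simp: hom_def cls_mult)


section \<open>Geodesic words\<close>

text \<open>
  Geodesic words take the place of reduced words. Minimality of the length yields directly what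
  reducedness would yield through the normal form theorem.
\<close>

definition geodesic :: "('v \<times> 'a) list \<Rightarrow> bool" where
  "geodesic w \<longleftrightarrow> w \<in> words \<and> (\<forall>w'. w' \<sim> w \<longrightarrow> length w \<le> length w')"

lemma geodesic_words: "geodesic w \<Longrightarrow> w \<in> words"
  by (simp add: geodesic_def)

lemma ex_geodesic:
  assumes "g \<in> carrier \<G>"
  shows "\<exists>w. geodesic w \<and> cls w = g"
proof -
  obtain w where w: "w \<in> words \<and> cls w = g"
    using assms by (auto simp: carrier_graph_product)
  define x where "x = arg_min length (\<lambda>w. w \<in> words \<and> cls w = g)"
  have x: "x \<in> words \<and> cls x = g" and min: "\<And>y. y \<in> words \<and> cls y = g \<Longrightarrow> length x \<le> length y"
    unfolding x_def
    using arg_min_natI[of "\<lambda>w. w \<in> words \<and> cls w = g", OF w]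
      arg_min_nat_le[of "\<lambda>w. w \<in> words \<and> cls w = g" _ length] by blast+
  have "length x \<le> length y" if "y \<sim> x" for y
    using min[of y] x cls_eq_iff[of y x] cong_wordsD[OF that] that by simp
  then show ?thesis using x by (auto simp: geodesic_def)
qed

lemma geodesic_subword:
  assumes "geodesic (x @ w @ y)"
  shows "geodesic w"
  using assms free_product_cong.subword[of V G "graph_product_relators E G" _ w x y]
  by (fastforce simp: geodesic_def)

lemma geodesic_letter_nontrivial:
  assumes "geodesic w" "(v, s) \<in> set w"
  shows "s \<noteq> \<one>\<^bsub>G v\<^esub>"
proof
  assume s: "s = \<one>\<^bsub>G v\<^esub>"
  obtain x y where w: "w = x @ [(v, s)] @ y"
    using assms(2) by (metis append_Cons append_Nil split_list)
  have "geodesic [(v, s)]" using assms(1) w geodesic_subword by blast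
  then have "[] \<sim> [(v, s)]"
    using s by (auto simp: geodesic_def intro: free_product_cong.sym free_product_cong.unit)
  with \<open>geodesic [(v, s)]\<close> show False by (fastforce simp: geodesic_def)
qed

definition star :: "'v \<Rightarrow> 'v set" where
  "star v = insert v {u. {v, u} \<in> E}"

text \<open>
  Deleting the letters outside \<open>S\<close> shortens a word, so a geodesic word whose class is fixed by the
  deletion has no such letters.
\<close>

lemma geodesic_restriction_fixed:
  assumes "geodesic w" "restriction S (cls w) = cls w"
  shows "fst ` set w \<subseteq> S"
proof -
  let ?f = "filter (\<lambda>a. fst a \<in> S) w"
  have "?f \<sim> w"
    using assms cls_eq_iff[of ?f w] by (simp add: restriction_cls geodesic_words)
  then have "length w \<le> length ?f" using assms by (simp add: geodesic_def)
  then have "?f = w"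
    using length_filter_less by (metis filter_True linorder_not_less)
  then show ?thesis by (auto simp: filter_id_conv)
qed

lemma letter_commutes_with_link:
  assumes "v \<in> V" "s \<in> carrier (G v)" "x \<in> words" "\<forall>a\<in>set x. {v, fst a} \<in> E"
  shows "(v, s) # x \<sim> x @ [(v, s)]"
proof -
  have "cls [(v, s)] \<otimes>\<^bsub>\<G>\<^esub> cls x = cls x \<otimes>\<^bsub>\<G>\<^esub> cls [(v, s)]"
    using assms(3,4)
  proof (induction x)
    case Nil
    then show ?case using assms by (simp add: cls_Nil)
  next
    case (Cons a x)
    obtain u t where a: "a = (u, t)" by fastforce
    let ?s = "cls [(v, s)]" and ?t = "cls [(u, t)]"
    have ut: "u \<in> V" "t \<in> carrier (G u)" "x \<in> words" "{v, u} \<in> E"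
      using Cons.prems a by auto
    have swap: "?s \<otimes>\<^bsub>\<G>\<^esub> ?t = ?t \<otimes>\<^bsub>\<G>\<^esub> ?s"
      using cls_commute[of v u s t] ut assms cls_append[of "[(v, s)]" "[(u, t)]"]
        cls_append[of "[(u, t)]" "[(v, s)]"] by simp
    have IH: "?s \<otimes>\<^bsub>\<G>\<^esub> cls x = cls x \<otimes>\<^bsub>\<G>\<^esub> ?s"
      using Cons by simp
    have "?s \<otimes>\<^bsub>\<G>\<^esub> (?t \<otimes>\<^bsub>\<G>\<^esub> cls x) = ?t \<otimes>\<^bsub>\<G>\<^esub> (?s \<otimes>\<^bsub>\<G>\<^esub> cls x)"
      using swap ut assms by (simp flip: \<G>.m_assoc)
    then show ?case
      using ut assms by (simp add: a cls_Cons[of u t x] IH \<G>.m_assoc)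
  qed
  then show ?thesis
    using assms cls_append[of x "[(v, s)]"] cls_Cons[of v s x]
      cls_eq_iff[of "(v, s) # x" "x @ [(v, s)]"] by simp
qed

text \<open>
  If \<open>x\<close> lies in the subgroup of \<open>star v\<close>, then its letters do, and the first letter of type \<open>v\<close>
  after the initial one could be merged with it across letters from the link of \<open>v\<close>.
\<close>

lemma geodesic_separates:
  assumes geo: "geodesic ((v, s) # x @ (v, t) # y)"
  shows "restriction (star v) (cls x) \<noteq> cls x"
proof
  assume fixed: "restriction (star v) (cls x) = cls x"
  have "geodesic x" using geodesic_subword[of "[(v, s)]" x "(v, t) # y"] geo by simp
  then have star: "fst ` set x \<subseteq> star v"
    by (rule geodesic_restriction_fixed) (rule fixed)
  \<comment> \<open>the final \<open>(v, t)\<close> guarantees that some letter has type \<open>v\<close>, so the first one exists\<close>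
  obtain z r u where zr: "x @ [(v, t)] = z @ (v, r) # u" and z: "\<forall>a\<in>set z. fst a \<noteq> v"
    using split_list_first_prop[of "x @ [(v, t)]" "\<lambda>a. fst a = v"] by fastforce
  have "set z \<subseteq> set x"
    by (metis (no_types, lifting) Un_iff butlast_snoc butlast_append list.distinct(1) set_append subsetI zr)
  then have link: "\<forall>a\<in>set z. {v, fst a} \<in> E"
    using star z by (fastforce simp: star_def)
  have geo': "geodesic ((v, s) # z @ [(v, r)])"
    using geodesic_subword[of "[]" "(v, s) # z @ [(v, r)]" "u @ y"] geo zr
    by (metis append.assoc append_Cons append_Nil)
  then have mem: "v \<in> V" "s \<in> carrier (G v)" "z \<in> words" "r \<in> carrier (G v)"
    by (auto dest!: geodesic_words)
  have "((v, s) # z) @ [(v, r)] \<sim> (z @ [(v, s)]) @ [(v, r)]"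
    using mem by (intro cong_append letter_commutes_with_link link free_product_cong.refl) auto
  moreover have "z @ [(v, s), (v, r)] \<sim> z @ [(v, s \<otimes>\<^bsub>G v\<^esub> r)]"
    using mem by (intro cong_append free_product_cong.refl free_product_cong.mult) auto
  ultimately have "z @ [(v, s \<otimes>\<^bsub>G v\<^esub> r)] \<sim> (v, s) # z @ [(v, r)]"
    by (auto intro: free_product_cong.sym free_product_cong.trans)
  then have "length ((v, s) # z @ [(v, r)]) \<le> length (z @ [(v, s \<otimes>\<^bsub>G v\<^esub> r)])"
    using geo' unfolding geodesic_def by blast
  then show False by simp
qed

end


section \<open>Affine isometric actions\<close>

lemma powr_add_le:
  fixes a b p :: real
  assumes "0 \<le> a" "0 \<le> b" "0 < p"
  shows "(a + b) powr p \<le> 2 powr p * (a powr p + b powr p)"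
proof -
  have "(a + b) powr p \<le> (2 * max a b) powr p"
    using assms by (intro powr_mono2) auto
  also have "\<dots> = 2 powr p * max a b powr p"
    using assms by (simp add: powr_mult)
  also have "\<dots> \<le> 2 powr p * (a powr p + b powr p)"
    by (intro mult_left_mono) (auto simp: max_def)
  finally show ?thesis .
qed

text \<open>
  The facts about \<open>L\<^sub>p\<close>-spaces that the constructions below use. The last axiom follows pointwise from
  \<open>(a + b)\<^sup>p \<le> 2\<^sup>p (a\<^sup>p + b\<^sup>p)\<close>, and it serves as well as the triangle inequality, because properness
  only asks which norms are bounded.
\<close>

locale p_normed_space =
  fixes p :: real and X :: "('k::real_normed_field, 'e) normed_space"
  assumes p_pos: "0 < p"
    and nonempty: "vectors X \<noteq> {}"
    and add_closed [simp, intro]: "\<And>x y. x \<in> vectors X \<Longrightarrow> y \<in> vectors X \<Longrightarrow> vadd X x y \<in> vectors X"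
    and scale_closed [simp, intro]: "\<And>c x. x \<in> vectors X \<Longrightarrow> vscale X c x \<in> vectors X"
    and add_assoc: "\<And>x y z. x \<in> vectors X \<Longrightarrow> y \<in> vectors X \<Longrightarrow> z \<in> vectors X \<Longrightarrow>
      vadd X (vadd X x y) z = vadd X x (vadd X y z)"
    and add_comm: "\<And>x y. x \<in> vectors X \<Longrightarrow> y \<in> vectors X \<Longrightarrow> vadd X x y = vadd X y x"
    and add_scale_0: "\<And>x y. x \<in> vectors X \<Longrightarrow> y \<in> vectors X \<Longrightarrow> vadd X x (vscale X 0 y) = x"
    and add_minus: "\<And>x. x \<in> vectors X \<Longrightarrow> vadd X x (vscale X (- 1) x) = vscale X 0 x"
    and norm_nonneg [simp]: "\<And>x. x \<in> vectors X \<Longrightarrow> 0 \<le> vnorm X x"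
    and norm_scale: "\<And>c x. x \<in> vectors X \<Longrightarrow> vnorm X (vscale X c x) = norm c * vnorm X x"
    and norm_add: "\<And>x y. x \<in> vectors X \<Longrightarrow> y \<in> vectors X \<Longrightarrow>
      vnorm X (vadd X x y) powr p \<le> 2 powr p * (vnorm X x powr p + vnorm X y powr p)"

definition vzero :: "('k::zero, 'e) normed_space \<Rightarrow> 'e" where
  "vzero X = vscale X 0 (SOME x. x \<in> vectors X)"

definition linear_isometry :: "('k, 'e) normed_space \<Rightarrow> ('k, 'f) normed_space \<Rightarrow> ('e \<Rightarrow> 'f) \<Rightarrow> bool" where
  "linear_isometry X Y f \<longleftrightarrow>
    (\<forall>x\<in>vectors X. f x \<in> vectors Y \<and> vnorm Y (f x) = vnorm X x) \<and>
    (\<forall>x\<in>vectors X. \<forall>y\<in>vectors X. f (vadd X x y) = vadd Y (f x) (f y)) \<and>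
    (\<forall>c. \<forall>x\<in>vectors X. f (vscale X c x) = vscale Y c (f x))"

lemma linear_isometryD:
  assumes "linear_isometry X Y f" "x \<in> vectors X"
  shows "f x \<in> vectors Y" "vnorm Y (f x) = vnorm X x"
    "y \<in> vectors X \<Longrightarrow> f (vadd X x y) = vadd Y (f x) (f y)"
    "f (vscale X c x) = vscale Y c (f x)"
  using assms by (auto simp: linear_isometry_def)

context p_normed_space
begin

lemma scale_0: "x \<in> vectors X \<Longrightarrow> vscale X 0 x = vzero X"
proof -
  assume x: "x \<in> vectors X"
  let ?y = "SOME y. y \<in> vectors X"
  have y: "?y \<in> vectors X" using x by (rule someI)
  have "vscale X 0 x = vadd X (vscale X 0 x) (vscale X 0 ?y)" using x y by (simp add: add_scale_0)
  also have "\<dots> = vadd X (vscale X 0 ?y) (vscale X 0 x)" using x y by (simp add: add_comm)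
  also have "\<dots> = vscale X 0 ?y" using x y by (simp add: add_scale_0)
  finally show ?thesis by (simp add: vzero_def)
qed

lemma zero_closed [simp, intro]: "vzero X \<in> vectors X"
  using nonempty by (auto simp flip: scale_0)

lemma add_0_right [simp]: "x \<in> vectors X \<Longrightarrow> vadd X x (vzero X) = x"
  using add_scale_0[of x x] by (simp add: scale_0)

lemma add_0_left [simp]: "x \<in> vectors X \<Longrightarrow> vadd X (vzero X) x = x"
  using add_comm[of x "vzero X"] by simp

lemma norm_zero [simp]: "vnorm X (vzero X) = 0"
  using nonempty norm_scale[of _ 0] by (auto simp: scale_0)

lemma scale_zero [simp]: "vscale X c (vzero X) = vzero X" if "c = - 1 \<or> c = 0"
  using that add_minus[of "vzero X"] by (auto simp: scale_0)

lemma add_minus' [simp]: "x \<in> vectors X \<Longrightarrow> vadd X x (vscale X (- 1) x) = vzero X"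
  by (simp add: add_minus scale_0)

lemma add_minus_left [simp]: "x \<in> vectors X \<Longrightarrow> vadd X (vscale X (- 1) x) x = vzero X"
  by (simp add: add_comm[of "vscale X (- 1) x"])

lemma add_left_comm:
  assumes "x \<in> vectors X" "y \<in> vectors X" "z \<in> vectors X"
  shows "vadd X x (vadd X y z) = vadd X y (vadd X x z)"
  using assms by (metis add_assoc add_comm)

lemmas add_ac = add_assoc add_comm add_left_comm

lemma add_eq_self: "x \<in> vectors X \<Longrightarrow> y \<in> vectors X \<Longrightarrow> x = vadd X x y \<Longrightarrow> y = vzero X"
  by (metis add_0_left add_assoc add_minus_left scale_closed)

lemma minus_add_cancel [simp]:
  "x \<in> vectors X \<Longrightarrow> y \<in> vectors X \<Longrightarrow> vadd X (vscale X (- 1) x) (vadd X x y) = y"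
  by (simp flip: add_assoc)

lemma linear_isometry_zero:
  assumes "linear_isometry X Y f" "p_normed_space p Y"
  shows "f (vzero X) = vzero Y"
  using linear_isometryD(1,4)[OF assms(1) zero_closed] scale_0[OF zero_closed]
    p_normed_space.scale_0[OF assms(2)] by metis

lemma linear_isometry_inv_into:
  assumes f: "linear_isometry X Y f" and bij: "bij_betw f (vectors X) (vectors Y)"
  shows "linear_isometry Y X (inv_into (vectors X) f)"
proof -
  let ?g = "inv_into (vectors X) f"
  have fg: "f (?g y) = y" and g: "?g y \<in> vectors X" if "y \<in> vectors Y" for y
    using that bij by (auto simp: bij_betw_inv_into_right bij_betwE[OF bij_betw_inv_into])
  have gf: "?g (f x) = x" if "x \<in> vectors X" for x
    using that bij by (auto simp: bij_betw_inv_into_left)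
  show ?thesis
    unfolding linear_isometry_def
  proof (intro conjI ballI allI)
    fix x y c assume x: "x \<in> vectors Y" and y: "y \<in> vectors Y"
    have "vadd Y x y = f (vadd X (?g x) (?g y))"
      using x y by (simp add: linear_isometryD[OF f] fg g)
    then show "?g (vadd Y x y) = vadd X (?g x) (?g y)"
      using x y by (simp add: gf g)
    have "vscale Y c x = f (vscale X c (?g x))"
      using x by (simp add: linear_isometryD[OF f] fg g)
    then show "?g (vscale Y c x) = vscale X c (?g x)"
      using x by (simp add: gf g)
  qed (auto simp: g linear_isometryD(2)[OF f, symmetric] fg)
qed

end

text \<open>
  \<open>GL X\<close> consists of bijections that are undefined outside \<open>X\<close>, hence the \<open>restrict\<close>; that the
  \<open>P g\<close> are bijective follows from the two group laws.
\<close>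

lemma affine_isometric_actionI:
  assumes "group H"
    and isom: "\<And>g. g \<in> carrier H \<Longrightarrow> linear_isometry X X (P g)"
    and one: "\<And>x. x \<in> vectors X \<Longrightarrow> P \<one>\<^bsub>H\<^esub> x = x"
    and mult: "\<And>g h x. g \<in> carrier H \<Longrightarrow> h \<in> carrier H \<Longrightarrow> x \<in> vectors X \<Longrightarrow>
      P (g \<otimes>\<^bsub>H\<^esub> h) x = P g (P h x)"
    and add_closed: "\<And>x y. x \<in> vectors X \<Longrightarrow> y \<in> vectors X \<Longrightarrow> vadd X x y \<in> vectors X"
    and scale_closed: "\<And>c x. x \<in> vectors X \<Longrightarrow> vscale X c x \<in> vectors X"
    and b: "\<And>g. g \<in> carrier H \<Longrightarrow> b g \<in> vectors X"
    and cocycle: "\<And>g h. g \<in> carrier H \<Longrightarrow> h \<in> carrier H \<Longrightarrow>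
      b (g \<otimes>\<^bsub>H\<^esub> h) = vadd X (P g (b h)) (b g)"
  shows "affine_isometric_action H X (\<lambda>g. restrict (P g) (vectors X)) b"
proof -
  interpret group H by fact
  let ?R = "\<lambda>g. restrict (P g) (vectors X)"
  note D = linear_isometryD[OF isom]
  have bij: "?R g \<in> Bij (vectors X)" if g: "g \<in> carrier H" for g
  proof -
    have "P (inv\<^bsub>H\<^esub> g) (P g x) = x" "P g (P (inv\<^bsub>H\<^esub> g) x) = x" if "x \<in> vectors X" for x
      using g that mult[of "inv\<^bsub>H\<^esub> g" g x] mult[of g "inv\<^bsub>H\<^esub> g" x] by (simp_all add: one)
    then have "bij_betw (P g) (vectors X) (vectors X)"
      using g by (intro bij_betw_byWitness[where f' = "P (inv\<^bsub>H\<^esub> g)"]) (auto simp: D)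
    then show ?thesis
      by (simp add: Bij_def cong: bij_betw_cong)
  qed
  have "?R \<in> hom H (GL X)"
    using bij by (auto simp: hom_def GL_def BijGroup_def D add_closed scale_closed mult compose_def)
  then show ?thesis
    using b cocycle by (auto simp: affine_isometric_action_def D)
qed

lemma affine_isometric_actionD:
  assumes "affine_isometric_action H X \<pi> b" "g \<in> carrier H"
  shows "linear_isometry X X (\<pi> g)" "b g \<in> vectors X"
    "h \<in> carrier H \<Longrightarrow> x \<in> vectors X \<Longrightarrow> \<pi> (g \<otimes>\<^bsub>H\<^esub> h) x = \<pi> g (\<pi> h x)"
    "h \<in> carrier H \<Longrightarrow> b (g \<otimes>\<^bsub>H\<^esub> h) = vadd X (\<pi> g (b h)) (b g)"
proof -
  have GL: "\<pi> k \<in> carrier (GL X)" if "k \<in> carrier H" for k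
    using assms(1) that by (auto simp: affine_isometric_action_def hom_def)
  then have Bij: "\<pi> k \<in> Bij (vectors X)" if "k \<in> carrier H" for k
    using that by (fastforce simp: GL_def)
  show "linear_isometry X X (\<pi> g)"
    using assms GL[OF assms(2)] Bij_imp_funcset[OF Bij[OF assms(2)]]
    by (auto simp: linear_isometry_def affine_isometric_action_def GL_def)
  show "\<pi> (g \<otimes>\<^bsub>H\<^esub> h) x = \<pi> g (\<pi> h x)" if "h \<in> carrier H" "x \<in> vectors X"
    using assms that Bij by (auto simp: affine_isometric_action_def hom_def GL_def BijGroup_def compose_def)
qed (use assms in \<open>auto simp: affine_isometric_action_def\<close>)

lemma affine_isometric_action_one:
  assumes "group H" "affine_isometric_action H X \<pi> b" "x \<in> vectors X"
  shows "\<pi> \<one>\<^bsub>H\<^esub> x = x"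
proof -
  interpret group H by fact
  have "\<pi> \<one>\<^bsub>H\<^esub> \<in> Bij (vectors X)"
    using assms(2) one_closed by (fastforce simp: affine_isometric_action_def hom_def GL_def)
  then have "inj_on (\<pi> \<one>\<^bsub>H\<^esub>) (vectors X)"
    by (auto simp: Bij_def bij_betw_def)
  moreover have "\<pi> \<one>\<^bsub>H\<^esub> (\<pi> \<one>\<^bsub>H\<^esub> x) = \<pi> \<one>\<^bsub>H\<^esub> x"
    using affine_isometric_actionD(3)[OF assms(2) one_closed one_closed assms(3)] by simp
  ultimately show ?thesis
    using assms(3) linear_isometryD(1)[OF affine_isometric_actionD(1)[OF assms(2) one_closed] assms(3)]
    by (auto dest: inj_onD)
qed

lemma affine_isometric_action_transfer:
  assumes H: "group H" and X: "p_normed_space p X" and Y: "affine_isometric_action H Y \<pi> b"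
    and f: "linear_isometry X Y f" and bij: "bij_betw f (vectors X) (vectors Y)"
  shows "\<exists>\<pi>' b'. affine_isometric_action H X \<pi>' b' \<and> (\<forall>g\<in>carrier H. vnorm X (b' g) = vnorm Y (b g))"
proof -
  interpret X: p_normed_space p X by fact
  let ?f' = "inv_into (vectors X) f"
  note f' = X.linear_isometry_inv_into[OF f bij]
  note act = affine_isometric_actionD[OF Y]
  note lin = linear_isometryD[OF f] linear_isometryD[OF f'] linear_isometryD[OF act(1)]
  have inv: "f (?f' y) = y" if "y \<in> vectors Y" for y
    using that bij by (simp add: bij_betw_inv_into_right)
  have "affine_isometric_action H X (\<lambda>g. \<lambda>x\<in>vectors X. ?f' (\<pi> g (f x))) (\<lambda>g. ?f' (b g))"
  proof (rule affine_isometric_actionI[OF H])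
    show "linear_isometry X X (\<lambda>x. ?f' (\<pi> g (f x)))" if "g \<in> carrier H" for g
      using that unfolding linear_isometry_def by (simp add: lin)
    show "?f' (\<pi> \<one>\<^bsub>H\<^esub> (f x)) = x" if "x \<in> vectors X" for x
      using that bij by (simp add: lin affine_isometric_action_one[OF H Y] bij_betw_inv_into_left)
  qed (simp_all add: lin act inv)
  moreover have "\<forall>g\<in>carrier H. vnorm X (?f' (b g)) = vnorm Y (b g)"
    by (simp add: lin act)
  ultimately show ?thesis by blast
qed

text \<open>
  Since \<open>b g = (\<pi> g x + b g) - \<pi> g x\<close> and \<open>\<pi> g\<close> is isometric, the orbit of \<open>x\<close> stays at
  bounded distance from the orbit of \<open>0\<close>, so properness need only be tested on the cocycle.
\<close>

lemma (in p_normed_space) proper_action_iff: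
  assumes H: "group H" and act: "affine_isometric_action H X \<pi> b"
  shows "proper_action H X \<pi> b \<longleftrightarrow> (\<forall>R. finite {g \<in> carrier H. vnorm X (b g) powr p \<le> R})"
proof
  note D = affine_isometric_actionD[OF act]
  note lin = linear_isometryD[OF D(1)]
  show "\<forall>R. finite {g \<in> carrier H. vnorm X (b g) powr p \<le> R}" if proper: "proper_action H X \<pi> b"
  proof
    fix R :: real
    \<comment> \<open>\<open>max\<close> makes \<open>M\<close> positive, as properness requires\<close>
    define M where "M = max 1 R powr (1 / p)"
    have M: "0 < M" "M powr p = max 1 R"
      using p_pos by (auto simp: M_def powr_powr)
    obtain F where F: "finite F"
      "\<And>g. g \<in> carrier H - F \<Longrightarrow> M < vnorm X (vadd X (\<pi> g (vzero X)) (b g))"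
      using proper M(1) zero_closed unfolding proper_action_def by metis
    have "{g \<in> carrier H. vnorm X (b g) powr p \<le> R} \<subseteq> F"
    proof
      fix g assume g: "g \<in> {g \<in> carrier H. vnorm X (b g) powr p \<le> R}"
      have "\<pi> g (vzero X) = vzero X"
        using g linear_isometry_zero[OF D(1)] p_normed_space_axioms by blast
      moreover have "\<not> M < vnorm X (b g)"
        using g M p_pos powr_less_mono2[of p M "vnorm X (b g)"] by auto
      ultimately show "g \<in> F" using F(2)[of g] g D(2) by auto
    qed
    then show "finite {g \<in> carrier H. vnorm X (b g) powr p \<le> R}"
      using F(1) finite_subset by blast
  qed
  show "proper_action H X \<pi> b" if fin: "\<forall>R. finite {g \<in> carrier H. vnorm X (b g) powr p \<le> R}"
    unfolding proper_action_def
  proof (intro allI impI ballI)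
    fix M :: real and x assume M: "0 < M" and x: "x \<in> vectors X"
    define R where "R = 2 powr p * (vnorm X x powr p + M powr p)"
    have "M < vnorm X (vadd X (\<pi> g x) (b g))" if g: "g \<in> carrier H" and R: "\<not> vnorm X (b g) powr p \<le> R" for g
    proof (rule ccontr)
      assume le: "\<not> M < vnorm X (vadd X (\<pi> g x) (b g))"
      let ?y = "\<pi> g x"
      have y: "?y \<in> vectors X" "vnorm X ?y = vnorm X x" "0 \<le> vnorm X x" and b: "b g \<in> vectors X"
        using g x lin D by auto
      have "vnorm X (b g) powr p = vnorm X (vadd X (vscale X (- 1) ?y) (vadd X ?y (b g))) powr p"
        using y b by simp
      also have "\<dots> \<le> 2 powr p * (vnorm X (vscale X (- 1) ?y) powr p + vnorm X (vadd X ?y (b g)) powr p)"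
        using y b by (intro norm_add) auto
      also have "\<dots> \<le> R"
        unfolding R_def using y b le M p_pos
        by (intro mult_left_mono add_mono powr_mono2) (auto simp: norm_scale)
      finally show False using R by simp
    qed
    then show "\<exists>F. finite F \<and> F \<subseteq> carrier H \<and>
        (\<forall>g\<in>carrier H - F. M < vnorm X (vadd X (\<pi> g x) (b g)))"
      using fin by (intro exI[of _ "{g \<in> carrier H. vnorm X (b g) powr p \<le> R}"]) auto
  qed
qed

lemma (in p_normed_space) proper_action_countable:
  assumes "group H" "affine_isometric_action H X \<pi> b" "proper_action H X \<pi> b"
  shows "countable (carrier H)"
proof -
  have "carrier H = (\<Union>n. {g \<in> carrier H. vnorm X (b g) powr p \<le> real n})"
    using real_arch_simple by auto
  also have "countable \<dots>"
    using assms proper_action_iff[OF assms(1,2)]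
    by (intro countable_UN[OF _ countable_finite]) auto
  finally show ?thesis .
qed

text \<open>Conjugating an affine action by the translation by \<open>\<xi>\<close> adds a coboundary to its cocycle.\<close>

lemma (in p_normed_space) affine_isometric_action_add_coboundary:
  assumes H: "group H" and act: "affine_isometric_action H X \<pi> b" and \<xi>: "\<xi> \<in> vectors X"
  shows "affine_isometric_action H X \<pi> (\<lambda>g. vadd X (b g) (vadd X (\<pi> g \<xi>) (vscale X (- 1) \<xi>)))"
proof -
  interpret group H by fact
  note D = affine_isometric_actionD[OF act]
  note lin = linear_isometryD[OF D(1)]
  let ?m = "\<lambda>x. vscale X (- 1) x"
  have "vadd X (b (g \<otimes>\<^bsub>H\<^esub> h)) (vadd X (\<pi> (g \<otimes>\<^bsub>H\<^esub> h) \<xi>) (?m \<xi>))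
      = vadd X (\<pi> g (vadd X (b h) (vadd X (\<pi> h \<xi>) (?m \<xi>)))) (vadd X (b g) (vadd X (\<pi> g \<xi>) (?m \<xi>)))"
    if gh: "g \<in> carrier H" "h \<in> carrier H" for g h
  proof -
    have mem: "\<pi> g (b h) \<in> vectors X" "b g \<in> vectors X" "\<pi> g (\<pi> h \<xi>) \<in> vectors X" "\<pi> g \<xi> \<in> vectors X"
      using gh \<xi> by (auto simp: D lin)
    have "vadd X (\<pi> g (vadd X (b h) (vadd X (\<pi> h \<xi>) (?m \<xi>)))) (vadd X (b g) (vadd X (\<pi> g \<xi>) (?m \<xi>)))
      = vadd X (vadd X (\<pi> g (b h)) (vadd X (\<pi> g (\<pi> h \<xi>)) (?m (\<pi> g \<xi>)))) (vadd X (b g) (vadd X (\<pi> g \<xi>) (?m \<xi>)))"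
      using gh \<xi> by (simp add: D lin)
    also have "\<dots> = vadd X (?m (\<pi> g \<xi>)) (vadd X (\<pi> g \<xi>)
        (vadd X (vadd X (\<pi> g (b h)) (b g)) (vadd X (\<pi> g (\<pi> h \<xi>)) (?m \<xi>))))"
      using mem \<xi> by (simp only: add_ac add_closed scale_closed)
    also have "\<dots> = vadd X (vadd X (\<pi> g (b h)) (b g)) (vadd X (\<pi> g (\<pi> h \<xi>)) (?m \<xi>))"
      using mem \<xi> by simp
    finally show ?thesis using gh \<xi> by (simp add: D)
  qed
  then show ?thesis
    using act \<xi> by (auto simp: affine_isometric_action_def lin)
qed


section \<open>\<open>L\<^sub>p\<close>-spaces\<close>

abbreviation Lp_energy :: "real \<Rightarrow> 'o measure \<Rightarrow> ('o \<Rightarrow> 'k::real_normed_field) \<Rightarrow> ennreal" where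
  "Lp_energy p M f \<equiv> \<integral>\<^sup>+x. ennreal (norm (f x) powr p) \<partial>M"

definition Lp_class ::
    "real \<Rightarrow> 'o measure \<Rightarrow> ('o \<Rightarrow> 'k::{real_normed_field, second_countable_topology}) \<Rightarrow> ('o \<Rightarrow> 'k) set" where
  "Lp_class p M f = Lp_rel p M `` {f}"

lemma Lp_functions_iff:
  "f \<in> Lp_functions p M \<longleftrightarrow> f \<in> borel_measurable M \<and> Lp_energy p M f < \<infinity>"
proof (cases "f \<in> borel_measurable M")
  case True
  then have "(\<lambda>x. norm (f x) powr p) \<in> borel_measurable M" by measurable
  then show ?thesis
    using True by (simp add: Lp_functions_def integrable_iff_bounded)
qed (simp add: Lp_functions_def)

lemma Lp_energy_add:
  assumes [measurable]: "f \<in> borel_measurable M" "g \<in> borel_measurable M" and "0 < p"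
  shows "Lp_energy p M (\<lambda>x. f x + g x) \<le> ennreal (2 powr p) * (Lp_energy p M f + Lp_energy p M g)"
proof -
  have "norm (f x + g x) powr p \<le> 2 powr p * (norm (f x) powr p + norm (g x) powr p)" for x
    using assms by (intro order_trans[OF powr_mono2 powr_add_le]) (auto intro: norm_triangle_ineq)
  then have "Lp_energy p M (\<lambda>x. f x + g x) \<le>
      (\<integral>\<^sup>+x. ennreal (2 powr p) * (ennreal (norm (f x) powr p) + ennreal (norm (g x) powr p)) \<partial>M)"
    by (intro nn_integral_mono) (simp add: ennreal_leI flip: ennreal_mult ennreal_plus)
  also have "\<dots> = ennreal (2 powr p) * (Lp_energy p M f + Lp_energy p M g)"
    by (simp add: nn_integral_cmult nn_integral_add)
  finally show ?thesis .
qed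

lemma Lp_energy_scale:
  fixes f :: "'o \<Rightarrow> 'k::{real_normed_field, second_countable_topology}"
  assumes [measurable]: "f \<in> borel_measurable M"
  shows "Lp_energy p M (\<lambda>x. c * f x) = ennreal (norm c powr p) * Lp_energy p M f"
proof -
  have "ennreal (norm (c * f x) powr p) = ennreal (norm c powr p) * ennreal (norm (f x) powr p)" for x
    by (simp add: norm_mult powr_mult flip: ennreal_mult)
  then show ?thesis by (simp add: nn_integral_cmult)
qed

lemma Lp_functions_add:
  assumes "0 < p" "f \<in> Lp_functions p M" "g \<in> Lp_functions p M"
  shows "(\<lambda>x. f x + g x) \<in> Lp_functions p M"
  using assms Lp_energy_add[of f M g p]
  by (auto simp: Lp_functions_iff ennreal_mult_less_top intro: order_le_less_trans)

lemma Lp_functions_scale: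
  assumes "f \<in> Lp_functions p M"
  shows "(\<lambda>x. c * f x) \<in> Lp_functions p M"
  using assms by (auto simp: Lp_functions_iff Lp_energy_scale ennreal_mult_less_top)

lemma equiv_Lp_rel:
  fixes M :: "'o measure"
  shows "equiv (Lp_functions p M)
    (Lp_rel p M :: (('o \<Rightarrow> 'k::{real_normed_field, second_countable_topology}) \<times> ('o \<Rightarrow> 'k)) set)"
proof (intro equivI refl_onI symI transI)
  fix f g h :: "'o \<Rightarrow> 'k" assume "(f, g) \<in> Lp_rel p M" "(g, h) \<in> Lp_rel p M"
  then show "(f, h) \<in> Lp_rel p M"
    by (auto simp: Lp_rel_def elim!: AE_mp)
qed (auto simp: Lp_rel_def)

lemma Lp_class_eq_iff:
  assumes "f \<in> Lp_functions p M" "g \<in> Lp_functions p M"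
  shows "Lp_class p M f = Lp_class p M g \<longleftrightarrow> (AE x in M. f x = g x)"
  unfolding Lp_class_def
  using eq_equiv_class_iff[OF equiv_Lp_rel assms] assms by (simp add: Lp_rel_def)

lemma vectors_Lp: "vectors (Lp p M) = Lp_class p M ` Lp_functions p M"
  by (auto simp: Lp_def quotient_def Lp_class_def)

lemma Lp_class_closed [simp]: "f \<in> Lp_functions p M \<Longrightarrow> Lp_class p M f \<in> vectors (Lp p M)"
  by (simp add: vectors_Lp)

lemma vadd_Lp:
  assumes "0 < p" "f \<in> Lp_functions p M" "g \<in> Lp_functions p M"
  shows "vadd (Lp p M) (Lp_class p M f) (Lp_class p M g) = Lp_class p M (\<lambda>x. f x + g x)"
proof -
  have "(\<lambda>f g. Lp_rel p M `` {\<lambda>x. f x + g x}) respects2 Lp_rel p M"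
    by (intro congruent2I' equiv_class_eq[OF equiv_Lp_rel])
      (auto simp: Lp_rel_def Lp_functions_add[OF assms(1)] elim!: AE_mp)
  from UN_equiv_class2[OF equiv_Lp_rel equiv_Lp_rel this assms(2,3)] show ?thesis
    by (simp add: Lp_def Lp_class_def)
qed

lemma vscale_Lp:
  assumes "f \<in> Lp_functions p M"
  shows "vscale (Lp p M) c (Lp_class p M f) = Lp_class p M (\<lambda>x. c * f x)"
proof -
  have "(\<lambda>f. Lp_rel p M `` {\<lambda>x. c * f x}) respects Lp_rel p M"
    by (intro congruentI equiv_class_eq[OF equiv_Lp_rel]) (auto simp: Lp_rel_def Lp_functions_scale)
  from UN_equiv_class[OF equiv_Lp_rel this assms] show ?thesis
    by (simp add: Lp_def Lp_class_def)
qed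

lemma vnorm_Lp:
  assumes "f \<in> Lp_functions p M"
  shows "vnorm (Lp p M) (Lp_class p M f) = enn2real (Lp_energy p M f) powr (1 / p)"
proof -
  have "(\<integral>x. norm (g x) powr p \<partial>M) = enn2real (Lp_energy p M f)" if "g \<in> Lp_class p M f" for g
  proof -
    have g: "g \<in> Lp_functions p M" and AE: "AE x in M. f x = g x"
      using that by (auto simp: Lp_class_def Lp_rel_def)
    have [measurable]: "g \<in> borel_measurable M" using g by (simp add: Lp_functions_iff)
    have "(\<integral>x. norm (g x) powr p \<partial>M) = enn2real (Lp_energy p M g)"
      by (intro integral_eq_nn_integral) auto
    also have "Lp_energy p M g = Lp_energy p M f"
      using AE by (intro nn_integral_cong_AE) auto
    finally show ?thesis .
  qed
  moreover have "f \<in> Lp_class p M f"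
    using assms by (auto simp: Lp_class_def Lp_rel_def)
  ultimately have "(\<lambda>g. (\<integral>x. norm (g x) powr p \<partial>M) powr (1 / p)) ` Lp_class p M f =
      {enn2real (Lp_energy p M f) powr (1 / p)}"
    by force
  then show ?thesis by (simp add: Lp_def)
qed

lemma vnorm_Lp_powr:
  assumes "0 < p" "f \<in> Lp_functions p M"
  shows "ennreal (vnorm (Lp p M) (Lp_class p M f) powr p) = Lp_energy p M f"
  using assms by (simp add: vnorm_Lp powr_powr Lp_functions_iff ennreal_enn2real)

lemma p_normed_space_Lp:
  fixes M :: "'o measure"
  assumes p: "0 < p"
  shows "p_normed_space p
    (Lp p M :: ('k::{real_normed_field, second_countable_topology}, ('o \<Rightarrow> 'k) set) normed_space)"
proof
  note [simp] = vadd_Lp[OF p] vscale_Lp Lp_functions_add[OF p] Lp_functions_scale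
  show "vectors (Lp p M :: ('k, ('o \<Rightarrow> 'k) set) normed_space) \<noteq> {}"
  proof -
    have "(\<lambda>x. 0 :: 'k) \<in> Lp_functions p M" by (simp add: Lp_functions_iff)
    then show ?thesis by (auto simp: vectors_Lp)
  qed
  fix x y z :: "('o \<Rightarrow> 'k) set" and c :: 'k
  assume "x \<in> vectors (Lp p M)"
  then obtain f where f: "f \<in> Lp_functions p M" "x = Lp_class p M f" by (auto simp: vectors_Lp)
  then show "vscale (Lp p M) c x \<in> vectors (Lp p M)" by simp
  show "vadd (Lp p M) x (vscale (Lp p M) (- 1) x) = vscale (Lp p M) 0 x"
    using f Lp_functions_scale[of f p M "-1"] by simp
  show "0 \<le> vnorm (Lp p M) x"
    using f by (simp add: vnorm_Lp)
  show "vnorm (Lp p M) (vscale (Lp p M) c x) = norm c * vnorm (Lp p M) x"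
  proof -
    have "f \<in> borel_measurable M" using f by (simp add: Lp_functions_iff)
    then show ?thesis
      using f p by (simp add: vnorm_Lp Lp_energy_scale enn2real_mult powr_mult powr_powr)
  qed
  assume "y \<in> vectors (Lp p M)"
  then obtain g where g: "g \<in> Lp_functions p M" "y = Lp_class p M g" by (auto simp: vectors_Lp)
  show "vadd (Lp p M) x y \<in> vectors (Lp p M)" using f g by simp
  show "vadd (Lp p M) x y = vadd (Lp p M) y x" using f g by (simp add: add.commute)
  show "vadd (Lp p M) x (vscale (Lp p M) 0 y) = x"
    using f g Lp_functions_scale[of g p M 0] by simp
  show "vnorm (Lp p M) (vadd (Lp p M) x y) powr p \<le>
      2 powr p * (vnorm (Lp p M) x powr p + vnorm (Lp p M) y powr p)"
  proof -
    have "ennreal (vnorm (Lp p M) (vadd (Lp p M) x y) powr p) \<le>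
        ennreal (2 powr p * (vnorm (Lp p M) x powr p + vnorm (Lp p M) y powr p))"
      using f g Lp_energy_add[of f M g p] p
      by (simp add: ennreal_mult vnorm_Lp_powr[OF p] Lp_functions_iff[of f] Lp_functions_iff[of g])
    then show ?thesis by (subst (asm) ennreal_le_iff) auto
  qed
  assume "z \<in> vectors (Lp p M)"
  then obtain h where h: "h \<in> Lp_functions p M" "z = Lp_class p M h" by (auto simp: vectors_Lp)
  show "vadd (Lp p M) (vadd (Lp p M) x y) z = vadd (Lp p M) x (vadd (Lp p M) y z)"
    using f g h by (simp add: add.assoc)
qed fact


section \<open>\<open>\<ell>\<^sub>p\<close>-sums\<close>

definition lp_energy :: "real \<Rightarrow> 'i set \<Rightarrow> ('i \<Rightarrow> ('k, 'e) normed_space) \<Rightarrow> ('i \<Rightarrow> 'e) \<Rightarrow> ennreal" where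
  "lp_energy p I L x = (\<integral>\<^sup>+i. ennreal (vnorm (L i) (x i) powr p) \<partial>count_space I)"

definition lp_sum :: "real \<Rightarrow> 'i set \<Rightarrow> ('i \<Rightarrow> ('k, 'e) normed_space) \<Rightarrow> ('k, 'i \<Rightarrow> 'e) normed_space" where
  "lp_sum p I L =
    \<lparr>vectors = {x \<in> \<Pi>\<^sub>E i\<in>I. vectors (L i). lp_energy p I L x < \<infinity>},
     vadd = (\<lambda>x y. \<lambda>i\<in>I. vadd (L i) (x i) (y i)),
     vscale = (\<lambda>c x. \<lambda>i\<in>I. vscale (L i) c (x i)),
     vnorm = (\<lambda>x. enn2real (lp_energy p I L x) powr (1 / p))\<rparr>"

lemma vectors_lp_sum:
  "x \<in> vectors (lp_sum p I L) \<longleftrightarrow> x \<in> (\<Pi>\<^sub>E i\<in>I. vectors (L i)) \<and> lp_energy p I L x < \<infinity>"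
  by (simp add: lp_sum_def)

lemma lp_sum_component [simp]: "x \<in> vectors (lp_sum p I L) \<Longrightarrow> i \<in> I \<Longrightarrow> x i \<in> vectors (L i)"
  by (auto simp: vectors_lp_sum)

lemma vadd_lp_sum: "vadd (lp_sum p I L) x y = (\<lambda>i\<in>I. vadd (L i) (x i) (y i))"
  by (simp add: lp_sum_def)

lemma vscale_lp_sum: "vscale (lp_sum p I L) c x = (\<lambda>i\<in>I. vscale (L i) c (x i))"
  by (simp add: lp_sum_def)

lemma lp_sum_eqI:
  assumes "x \<in> vectors (lp_sum p I L)" "y \<in> vectors (lp_sum p I L)" "\<And>i. i \<in> I \<Longrightarrow> x i = y i"
  shows "x = y"
  using assms by (auto simp: vectors_lp_sum intro: PiE_ext)

text \<open>
  The sum over the index set is the integral over its counting measure, with values in \<open>[0, \<infinity>]\<close>.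
  This needs no summability assumption, and bijections of the index set and monotone limits are
  treated as for any other integral.
\<close>

locale p_normed_family =
  fixes p :: real and I :: "'i set" and L :: "'i \<Rightarrow> ('k::real_normed_field, 'e) normed_space"
  assumes p_pos: "0 < p"
    and p_normed: "i \<in> I \<Longrightarrow> p_normed_space p (L i)"
begin

abbreviation Y :: "('k, 'i \<Rightarrow> 'e) normed_space" where
  "Y \<equiv> lp_sum p I L"

lemma vnorm_lp_sum_powr:
  "x \<in> vectors Y \<Longrightarrow> ennreal (vnorm Y x powr p) = lp_energy p I L x"
  using p_pos by (simp add: vectors_lp_sum) (simp add: lp_sum_def powr_powr ennreal_enn2real)

lemma component_powr_le:
  assumes "x \<in> vectors Y" "i \<in> I"
  shows "vnorm (L i) (x i) powr p \<le> vnorm Y x powr p"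
proof -
  have "ennreal (vnorm (L i) (x i) powr p) =
      (\<integral>\<^sup>+j. ennreal (vnorm (L j) (x j) powr p) * indicator {i} j \<partial>count_space I)"
    using assms by (subst nn_integral_indicator_singleton) auto
  also have "\<dots> \<le> lp_energy p I L x"
    unfolding lp_energy_def by (intro nn_integral_mono) (auto simp: indicator_def)
  also have "\<dots> = ennreal (vnorm Y x powr p)"
    using assms by (simp add: vnorm_lp_sum_powr)
  finally show ?thesis by (subst (asm) ennreal_le_iff) auto
qed

lemma lp_energy_add:
  assumes "x \<in> vectors Y" "y \<in> vectors Y"
  shows "lp_energy p I L (vadd Y x y) \<le> ennreal (2 powr p) * (lp_energy p I L x + lp_energy p I L y)"
proof -
  have "lp_energy p I L (vadd Y x y) \<le> (\<integral>\<^sup>+i. ennreal (2 powr p) *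
      (ennreal (vnorm (L i) (x i) powr p) + ennreal (vnorm (L i) (y i) powr p)) \<partial>count_space I)"
    unfolding lp_energy_def using assms
    by (intro nn_integral_mono)
      (simp add: vadd_lp_sum ennreal_leI p_normed_space.norm_add[OF p_normed] flip: ennreal_mult ennreal_plus)
  also have "\<dots> = ennreal (2 powr p) * (lp_energy p I L x + lp_energy p I L y)"
    by (simp add: nn_integral_cmult nn_integral_add lp_energy_def)
  finally show ?thesis .
qed

lemma lp_energy_scale:
  assumes "x \<in> vectors Y"
  shows "lp_energy p I L (vscale Y c x) = ennreal (norm c powr p) * lp_energy p I L x"
proof -
  have "lp_energy p I L (vscale Y c x) =
      (\<integral>\<^sup>+i. ennreal (norm c powr p) * ennreal (vnorm (L i) (x i) powr p) \<partial>count_space I)"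
    unfolding lp_energy_def using assms
    by (intro nn_integral_cong)
      (simp add: vscale_lp_sum p_normed_space.norm_scale[OF p_normed] powr_mult
        p_normed_space.norm_nonneg[OF p_normed] flip: ennreal_mult)
  then show ?thesis by (simp add: nn_integral_cmult lp_energy_def)
qed

lemma p_normed_space_lp_sum: "p_normed_space p Y"
proof
  note L = p_normed_space.add_closed[OF p_normed] p_normed_space.scale_closed[OF p_normed]
    p_normed_space.zero_closed[OF p_normed] p_normed_space.norm_zero[OF p_normed]
    p_normed_space.add_assoc[OF p_normed] p_normed_space.add_scale_0[OF p_normed]
    p_normed_space.add_minus[OF p_normed]
  show "vectors Y \<noteq> {}"
  proof -
    have "lp_energy p I L (\<lambda>i\<in>I. vzero (L i)) = (\<integral>\<^sup>+i. 0 \<partial>count_space I)"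
      unfolding lp_energy_def using p_pos by (intro nn_integral_cong) (simp add: L)
    then have "(\<lambda>i\<in>I. vzero (L i)) \<in> vectors Y"
      by (auto simp: vectors_lp_sum L)
    then show ?thesis by blast
  qed
  fix x y z :: "'i \<Rightarrow> 'e" and c :: 'k
  assume x: "x \<in> vectors Y"
  then have ext: "restrict x I = x" by (auto simp: vectors_lp_sum PiE_restrict)
  show "vscale Y c x \<in> vectors Y"
    using x lp_energy_scale[OF x, of c] by (auto simp: vectors_lp_sum vscale_lp_sum L ennreal_mult_less_top)
  show "vadd Y x (vscale Y (- 1) x) = vscale Y 0 x"
    using x by (auto simp: vadd_lp_sum vscale_lp_sum L)
  show "0 \<le> vnorm Y x" by (simp add: lp_sum_def)
  show "vnorm Y (vscale Y c x) = norm c * vnorm Y x"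
    using p_pos lp_energy_scale[OF x, of c]
    by (simp add: lp_sum_def enn2real_mult powr_mult powr_powr)
  assume y: "y \<in> vectors Y"
  have "lp_energy p I L (vadd Y x y) < \<infinity>"
    using x y by (intro order_le_less_trans[OF lp_energy_add[OF x y]])
      (auto simp: vectors_lp_sum ennreal_mult_less_top)
  then show xy: "vadd Y x y \<in> vectors Y"
    using x y by (auto simp: vectors_lp_sum vadd_lp_sum L)
  show "vadd Y x y = vadd Y y x"
    using x y p_normed_space.add_comm[OF p_normed] by (auto simp: vadd_lp_sum)
  show "vadd Y x (vscale Y 0 y) = x"
    using x y ext by (auto simp: vadd_lp_sum vscale_lp_sum L cong: restrict_cong)
  show "vnorm Y (vadd Y x y) powr p \<le> 2 powr p * (vnorm Y x powr p + vnorm Y y powr p)"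
  proof -
    have "ennreal (vnorm Y (vadd Y x y) powr p) \<le> ennreal (2 powr p * (vnorm Y x powr p + vnorm Y y powr p))"
      using x y xy lp_energy_add[OF x y] by (simp add: ennreal_mult vnorm_lp_sum_powr)
    then show ?thesis by (subst (asm) ennreal_le_iff) auto
  qed
  assume z: "z \<in> vectors Y"
  show "vadd Y (vadd Y x y) z = vadd Y x (vadd Y y z)"
    using x y z by (auto simp: vadd_lp_sum L)
qed (rule p_pos)

end


section \<open>An \<open>\<ell>\<^sub>p\<close>-sum of \<open>L\<^sub>p\<close>-spaces is an \<open>L\<^sub>p\<close>-space\<close>

text \<open>
  The disjoint union of the measure spaces \<open>M i\<close>, laid out inside the type \<open>'q\<close> by the injection
  \<open>e\<close>: a set is measurable if all its slices are, and its measure is the sum of the measures of its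
  slices.
\<close>

locale disjoint_union_of_measures =
  fixes I :: "'i set" and M :: "'i \<Rightarrow> 'o measure" and e :: "'i \<times> 'o \<Rightarrow> 'q"
  assumes inj: "inj_on e (I \<times> UNIV)"
begin

definition points :: "'q set" where
  "points = e ` (SIGMA i:I. space (M i))"

definition slice :: "'q set \<Rightarrow> 'i \<Rightarrow> 'o set" where
  "slice A i = {x \<in> space (M i). e (i, x) \<in> A}"

definition N :: "'q measure" where
  "N = measure_of points {A. A \<subseteq> points \<and> (\<forall>i\<in>I. slice A i \<in> sets (M i))}
    (\<lambda>A. \<integral>\<^sup>+i. emeasure (M i) (slice A i) \<partial>count_space I)"

lemma sigma_algebra_N: "sigma_algebra points {A. A \<subseteq> points \<and> (\<forall>i\<in>I. slice A i \<in> sets (M i))}"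
proof (rule sigma_algebra_iff2[THEN iffD2], intro conjI ballI allI impI)
  fix A assume A: "A \<in> {A. A \<subseteq> points \<and> (\<forall>i\<in>I. slice A i \<in> sets (M i))}"
  have "slice (points - A) i = space (M i) - slice A i" if "i \<in> I" for i
    using that by (auto simp: slice_def points_def)
  then show "points - A \<in> {A. A \<subseteq> points \<and> (\<forall>i\<in>I. slice A i \<in> sets (M i))}"
    using A by auto
next
  fix A :: "nat \<Rightarrow> 'q set" assume A: "range A \<subseteq> {A. A \<subseteq> points \<and> (\<forall>i\<in>I. slice A i \<in> sets (M i))}"
  have "slice (\<Union>n. A n) i = (\<Union>n. slice (A n) i)" for i
    by (auto simp: slice_def)
  moreover have "(\<Union>n. A n) \<subseteq> points" "i \<in> I \<Longrightarrow> slice (A n) i \<in> sets (M i)" for n i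
    using A by auto
  ultimately show "(\<Union>n. A n) \<in> {A. A \<subseteq> points \<and> (\<forall>i\<in>I. slice A i \<in> sets (M i))}"
    by auto
qed (auto simp: slice_def)

lemma space_N: "space N = points"
  and sets_N: "sets N = {A. A \<subseteq> points \<and> (\<forall>i\<in>I. slice A i \<in> sets (M i))}"
proof -
  interpret sigma_algebra points "{A. A \<subseteq> points \<and> (\<forall>i\<in>I. slice A i \<in> sets (M i))}"
    by (rule sigma_algebra_N)
  show "space N = points" "sets N = {A. A \<subseteq> points \<and> (\<forall>i\<in>I. slice A i \<in> sets (M i))}"
    using space_closed by (simp_all add: N_def space_measure_of sets_measure_of_eq)
qed

lemma emeasure_N:
  assumes "A \<in> sets N"
  shows "emeasure N A = (\<integral>\<^sup>+i. emeasure (M i) (slice A i) \<partial>count_space I)"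
proof (rule emeasure_measure_of[OF N_def])
  show "positive (sets N) (\<lambda>A. \<integral>\<^sup>+i. emeasure (M i) (slice A i) \<partial>count_space I)"
    by (simp add: positive_def slice_def)
  show "countably_additive (sets N) (\<lambda>A. \<integral>\<^sup>+i. emeasure (M i) (slice A i) \<partial>count_space I)"
  proof (rule countably_additiveI)
    fix A :: "nat \<Rightarrow> 'q set" assume A: "range A \<subseteq> sets N" "disjoint_family A"
    have "(\<Sum>n. \<integral>\<^sup>+i. emeasure (M i) (slice (A n) i) \<partial>count_space I)
        = (\<integral>\<^sup>+i. (\<Sum>n. emeasure (M i) (slice (A n) i)) \<partial>count_space I)"
      by (rule nn_integral_suminf[symmetric]) simp
    also have "\<dots> = (\<integral>\<^sup>+i. emeasure (M i) (slice (\<Union>n. A n) i) \<partial>count_space I)"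
    proof (intro nn_integral_cong)
      fix i assume i: "i \<in> space (count_space I)"
      have "disjoint_family (\<lambda>n. slice (A n) i)"
        using A(2) unfolding disjoint_family_on_def slice_def by blast
      then have "(\<Sum>n. emeasure (M i) (slice (A n) i)) = emeasure (M i) (\<Union>n. slice (A n) i)"
        using A(1) i by (intro suminf_emeasure) (auto simp: sets_N)
      also have "(\<Union>n. slice (A n) i) = slice (\<Union>n. A n) i"
        by (auto simp: slice_def)
      finally show "(\<Sum>n. emeasure (M i) (slice (A n) i)) = emeasure (M i) (slice (\<Union>n. A n) i)" .
    qed
    finally show "(\<Sum>n. \<integral>\<^sup>+i. emeasure (M i) (slice (A n) i) \<partial>count_space I)
        = (\<integral>\<^sup>+i. emeasure (M i) (slice (\<Union>n. A n) i) \<partial>count_space I)" .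
  qed
qed (use assms sets.sets_into_space in \<open>auto simp: sets_N\<close>)

lemma measurable_slice: "i \<in> I \<Longrightarrow> (\<lambda>x. e (i, x)) \<in> M i \<rightarrow>\<^sub>M N"
proof (rule measurableI)
  fix A assume "i \<in> I" "A \<in> sets N"
  moreover have "(\<lambda>x. e (i, x)) -` A \<inter> space (M i) = slice A i"
    by (auto simp: slice_def)
  ultimately show "(\<lambda>x. e (i, x)) -` A \<inter> space (M i) \<in> sets (M i)"
    by (simp add: sets_N)
qed (auto simp: space_N points_def)

lemma measurable_N_iff:
  assumes "\<And>y. f y \<in> space L"
  shows "f \<in> N \<rightarrow>\<^sub>M L \<longleftrightarrow> (\<forall>i\<in>I. (\<lambda>x. f (e (i, x))) \<in> M i \<rightarrow>\<^sub>M L)"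
proof
  assume "f \<in> N \<rightarrow>\<^sub>M L"
  then show "\<forall>i\<in>I. (\<lambda>x. f (e (i, x))) \<in> M i \<rightarrow>\<^sub>M L"
    using measurable_compose[OF measurable_slice] by blast
next
  assume f: "\<forall>i\<in>I. (\<lambda>x. f (e (i, x))) \<in> M i \<rightarrow>\<^sub>M L"
  show "f \<in> N \<rightarrow>\<^sub>M L"
  proof (rule measurableI)
    fix A assume A: "A \<in> sets L"
    have "slice (f -` A \<inter> space N) i = (\<lambda>x. f (e (i, x))) -` A \<inter> space (M i)" if "i \<in> I" for i
      using that by (auto simp: slice_def space_N points_def)
    then show "f -` A \<inter> space N \<in> sets N"
      using f A measurable_sets by (fastforce simp: sets_N space_N)
  qed (rule assms)
qed

lemma nn_integral_N:
  assumes "f \<in> borel_measurable N"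
  shows "(\<integral>\<^sup>+y. f y \<partial>N) = (\<integral>\<^sup>+i. (\<integral>\<^sup>+x. f (e (i, x)) \<partial>M i) \<partial>count_space I)"
  using assms
proof (induction rule: borel_measurable_induct)
  case (cong f g)
  have "(\<integral>\<^sup>+x. f (e (i, x)) \<partial>M i) = (\<integral>\<^sup>+x. g (e (i, x)) \<partial>M i)" if "i \<in> I" for i
    using that cong(3) by (intro nn_integral_cong) (auto simp: space_N points_def)
  moreover have "(\<integral>\<^sup>+y. f y \<partial>N) = (\<integral>\<^sup>+y. g y \<partial>N)"
    using cong(3) by (intro nn_integral_cong)
  ultimately show ?case
    using cong(4) by (simp cong: nn_integral_cong_simp)
next
  case (set A)
  have "(\<integral>\<^sup>+x. indicator A (e (i, x)) \<partial>M i) = emeasure (M i) (slice A i)" if "i \<in> I" for i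
  proof -
    have "(\<integral>\<^sup>+x. indicator A (e (i, x)) \<partial>M i) = (\<integral>\<^sup>+x. indicator (slice A i) x \<partial>M i)"
      by (intro nn_integral_cong) (auto simp: slice_def indicator_def)
    then show ?thesis using set that by (simp add: sets_N)
  qed
  then show ?case
    using set by (simp add: emeasure_N cong: nn_integral_cong_simp)
next
  case (mult u c)
  note [measurable] = mult(2)
  have "(\<integral>\<^sup>+x. c * u (e (i, x)) \<partial>M i) = c * (\<integral>\<^sup>+x. u (e (i, x)) \<partial>M i)" if "i \<in> I" for i
    using measurable_compose[OF measurable_slice[OF that] mult(2)] by (rule nn_integral_cmult)
  then show ?case
    using mult by (simp add: nn_integral_cmult cong: nn_integral_cong_simp)
next
  case (add u v)
  have "(\<integral>\<^sup>+x. v (e (i, x)) + u (e (i, x)) \<partial>M i) =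
      (\<integral>\<^sup>+x. v (e (i, x)) \<partial>M i) + (\<integral>\<^sup>+x. u (e (i, x)) \<partial>M i)" if "i \<in> I" for i
    using measurable_compose[OF measurable_slice[OF that]] add(1,3) by (intro nn_integral_add) auto
  then show ?case
    using add by (simp add: nn_integral_add cong: nn_integral_cong_simp)
next
  case (seq U)
  have meas: "(\<lambda>x. U n (e (i, x))) \<in> borel_measurable (M i)" if "i \<in> I" for i n
    using measurable_compose[OF measurable_slice[OF that] seq(1)] .
  have "(\<integral>\<^sup>+x. (SUP n. U n) (e (i, x)) \<partial>M i) = (SUP n. \<integral>\<^sup>+x. U n (e (i, x)) \<partial>M i)" if "i \<in> I" for i
    using meas[OF that] seq(3)
    by (simp add: image_image SUP_apply) (intro nn_integral_monotone_convergence_SUP; auto simp: incseq_def le_fun_def)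
  then have "(\<integral>\<^sup>+i. \<integral>\<^sup>+x. (SUP n. U n) (e (i, x)) \<partial>M i \<partial>count_space I) =
      (\<integral>\<^sup>+i. (SUP n. \<integral>\<^sup>+x. U n (e (i, x)) \<partial>M i) \<partial>count_space I)"
    by (intro nn_integral_cong) simp
  also have "\<dots> = (SUP n. \<integral>\<^sup>+i. \<integral>\<^sup>+x. U n (e (i, x)) \<partial>M i \<partial>count_space I)"
    using seq(3) by (intro nn_integral_monotone_convergence_SUP)
      (auto simp: incseq_def le_fun_def intro!: nn_integral_mono)
  also have "\<dots> = (SUP n. \<integral>\<^sup>+y. U n y \<partial>N)"
    using seq by simp
  also have "\<dots> = (\<integral>\<^sup>+y. (SUP n. U n y) \<partial>N)"
    using seq(1,3) by (intro nn_integral_monotone_convergence_SUP[symmetric]) auto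
  finally show ?case by (simp add: image_image SUP_apply)
qed

text \<open>
  Equality almost everywhere is the vanishing of the integral of the distance, and an integral over
  \<open>N\<close> is a sum of integrals over the slices.
\<close>

lemma AE_eq_N_iff:
  fixes f g :: "'q \<Rightarrow> 'k::{real_normed_field, second_countable_topology}"
  assumes "f \<in> borel_measurable N" "g \<in> borel_measurable N"
  shows "(AE y in N. f y = g y) \<longleftrightarrow> (\<forall>i\<in>I. AE x in M i. f (e (i, x)) = g (e (i, x)))"
proof -
  have zero: "(AE y in L. u y = v y) \<longleftrightarrow> (\<integral>\<^sup>+y. ennreal (norm (u y - v y)) \<partial>L) = 0"
    if "u \<in> borel_measurable L" "v \<in> borel_measurable L" for u v :: "'z \<Rightarrow> 'k" and L
    using that by (subst nn_integral_0_iff_AE) auto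
  have "(AE y in N. f y = g y) \<longleftrightarrow>
      (\<integral>\<^sup>+i. \<integral>\<^sup>+x. ennreal (norm (f (e (i, x)) - g (e (i, x)))) \<partial>M i \<partial>count_space I) = 0"
    using assms by (simp add: zero nn_integral_N)
  also have "\<dots> \<longleftrightarrow> (\<forall>i\<in>I. (\<integral>\<^sup>+x. ennreal (norm (f (e (i, x)) - g (e (i, x)))) \<partial>M i) = 0)"
    by (subst nn_integral_0_iff_AE) (auto simp: AE_count_space)
  also have "\<dots> \<longleftrightarrow> (\<forall>i\<in>I. AE x in M i. f (e (i, x)) = g (e (i, x)))"
    using measurable_compose[OF measurable_slice assms(1)] measurable_compose[OF measurable_slice assms(2)]
    by (simp add: zero)
  finally show ?thesis .
qed

lemma Lp_energy_N:
  fixes f :: "'q \<Rightarrow> 'k::{real_normed_field, second_countable_topology}"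
  assumes [measurable]: "f \<in> borel_measurable N"
  shows "Lp_energy p N f = (\<integral>\<^sup>+i. Lp_energy p (M i) (\<lambda>x. f (e (i, x))) \<partial>count_space I)"
  by (rule nn_integral_N) measurable

lemma Lp_functions_slice:
  assumes "f \<in> Lp_functions p N" "i \<in> I"
  shows "(\<lambda>x. f (e (i, x))) \<in> Lp_functions p (M i)"
proof -
  have meas: "f \<in> borel_measurable N" and fin: "Lp_energy p N f < \<infinity>"
    using assms by (auto simp: Lp_functions_iff)
  have "Lp_energy p (M i) (\<lambda>x. f (e (i, x))) =
      (\<integral>\<^sup>+j. Lp_energy p (M j) (\<lambda>x. f (e (j, x))) * indicator {i} j \<partial>count_space I)"
    using assms(2) by (subst nn_integral_indicator_singleton) auto
  also have "\<dots> \<le> (\<integral>\<^sup>+j. Lp_energy p (M j) (\<lambda>x. f (e (j, x))) \<partial>count_space I)"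
    by (intro nn_integral_mono) (auto simp: indicator_def)
  also have "\<dots> = Lp_energy p N f"
    using Lp_energy_N[OF meas] by simp
  also note fin
  finally show ?thesis
    using measurable_compose[OF measurable_slice[OF assms(2)] meas] by (simp add: Lp_functions_iff)
qed

text \<open>
  The isomorphism onto the \<open>\<ell>\<^sub>p\<close>-sum cuts a function into its restrictions to the slices. It is read
  off from some representative of the class.
\<close>

definition split_Lp ::
    "real \<Rightarrow> ('q \<Rightarrow> 'k::{real_normed_field, second_countable_topology}) set \<Rightarrow> 'i \<Rightarrow> ('o \<Rightarrow> 'k) set" where
  "split_Lp p X = (\<lambda>i\<in>I. Lp_class p (M i) (\<lambda>x. (SOME f. f \<in> X) (e (i, x))))"

lemma split_Lp_class:
  fixes f :: "'q \<Rightarrow> 'k::{real_normed_field, second_countable_topology}"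
  assumes f: "f \<in> Lp_functions p N"
  shows "split_Lp p (Lp_class p N f) = (\<lambda>i\<in>I. Lp_class p (M i) (\<lambda>x. f (e (i, x))))"
proof -
  let ?g = "SOME g. g \<in> Lp_class p N f"
  have "?g \<in> Lp_class p N f"
    by (rule someI[of _ f]) (use f in \<open>simp add: Lp_class_def Lp_rel_def\<close>)
  then have g: "?g \<in> Lp_functions p N" and "AE y in N. f y = ?g y"
    by (auto simp: Lp_class_def Lp_rel_def)
  then have "\<forall>i\<in>I. AE x in M i. f (e (i, x)) = ?g (e (i, x))"
    using f by (subst (asm) AE_eq_N_iff) (auto simp: Lp_functions_iff)
  then show ?thesis
    using f g unfolding split_Lp_def
    by (intro restrict_ext) (simp add: Lp_class_eq_iff Lp_functions_slice[OF f] Lp_functions_slice[OF g] eq_commute)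
qed

lemma split_Lp_isometry:
  fixes p :: real
  assumes p: "0 < p"
  defines "L \<equiv> \<lambda>i. Lp p (M i) :: ('k::{real_normed_field, second_countable_topology}, ('o \<Rightarrow> 'k) set) normed_space"
  shows "linear_isometry (Lp p N) (lp_sum p I L) (split_Lp p)"
    and "bij_betw (split_Lp p) (vectors (Lp p N)) (vectors (lp_sum p I L))"
proof -
  have energy: "lp_energy p I L (split_Lp p (Lp_class p N f)) = Lp_energy p N f"
    if "f \<in> Lp_functions p N" for f
  proof -
    have "lp_energy p I L (split_Lp p (Lp_class p N f)) =
        (\<integral>\<^sup>+i. Lp_energy p (M i) (\<lambda>x. f (e (i, x))) \<partial>count_space I)"
      using that unfolding lp_energy_def L_def
      by (intro nn_integral_cong) (simp add: split_Lp_class vnorm_Lp_powr[OF p] Lp_functions_slice[OF that])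
    then show ?thesis using that by (simp add: Lp_energy_N Lp_functions_iff)
  qed
  have closed: "split_Lp p (Lp_class p N f) \<in> vectors (lp_sum p I L)" if "f \<in> Lp_functions p N" for f
  proof -
    have "lp_energy p I L (split_Lp p (Lp_class p N f)) < \<infinity>"
      unfolding energy[OF that] using that by (simp add: Lp_functions_iff)
    moreover have "split_Lp p (Lp_class p N f) \<in> (\<Pi>\<^sub>E i\<in>I. vectors (L i))"
      using that by (simp add: split_Lp_class L_def Lp_functions_slice[OF that])
    ultimately show ?thesis by (simp add: vectors_lp_sum)
  qed
  show "linear_isometry (Lp p N) (lp_sum p I L) (split_Lp p)"
    unfolding linear_isometry_def
  proof (intro conjI ballI allI)
    fix X Y :: "('q \<Rightarrow> 'k) set" and c :: 'k assume "X \<in> vectors (Lp p N)"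
    then obtain f where f: "f \<in> Lp_functions p N" "X = Lp_class p N f" by (auto simp: vectors_Lp)
    show "split_Lp p X \<in> vectors (lp_sum p I L)" using closed f by simp
    show "vnorm (lp_sum p I L) (split_Lp p X) = vnorm (Lp p N) X"
      using f energy by (simp add: lp_sum_def vnorm_Lp)
    show "split_Lp p (vscale (Lp p N) c X) = vscale (lp_sum p I L) c (split_Lp p X)"
      using f by (simp add: vscale_Lp split_Lp_class Lp_functions_scale vscale_lp_sum L_def
          Lp_functions_slice[OF f(1)] cong: restrict_cong)
    assume "Y \<in> vectors (Lp p N)"
    then obtain g where g: "g \<in> Lp_functions p N" "Y = Lp_class p N g" by (auto simp: vectors_Lp)
    show "split_Lp p (vadd (Lp p N) X Y) = vadd (lp_sum p I L) (split_Lp p X) (split_Lp p Y)"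
      using f g by (simp add: vadd_Lp[OF p] split_Lp_class Lp_functions_add[OF p] vadd_lp_sum L_def
          Lp_functions_slice[OF f(1)] Lp_functions_slice[OF g(1)] cong: restrict_cong)
  qed
  have "inj_on (split_Lp p) (vectors (Lp p N) :: ('q \<Rightarrow> 'k) set set)"
  proof (rule inj_onI)
    fix X Y :: "('q \<Rightarrow> 'k) set"
    assume "X \<in> vectors (Lp p N)" "Y \<in> vectors (Lp p N)" and eq: "split_Lp p X = split_Lp p Y"
    then obtain f g where f: "f \<in> Lp_functions p N" "X = Lp_class p N f"
      and g: "g \<in> Lp_functions p N" "Y = Lp_class p N g" by (auto simp: vectors_Lp)
    have "AE x in M i. f (e (i, x)) = g (e (i, x))" if i: "i \<in> I" for i
      using fun_cong[OF eq, of i] f g i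
      by (simp add: split_Lp_class Lp_class_eq_iff Lp_functions_slice[OF f(1)] Lp_functions_slice[OF g(1)])
    then have "AE y in N. f y = g y"
      using f g by (subst AE_eq_N_iff) (auto simp: Lp_functions_iff)
    then show "X = Y" using f g by (simp add: Lp_class_eq_iff)
  qed
  moreover have "x \<in> split_Lp p ` vectors (Lp p N)" if x: "x \<in> vectors (lp_sum p I L)" for x
  proof -
    have "\<exists>f. f \<in> Lp_functions p (M i) \<and> x i = Lp_class p (M i) f" if "i \<in> I" for i
      using lp_sum_component[OF x that] by (auto simp: L_def vectors_Lp)
    then obtain F where F: "\<And>i. i \<in> I \<Longrightarrow> F i \<in> Lp_functions p (M i) \<and> x i = Lp_class p (M i) (F i)"
      by metis
    \<comment> \<open>the representatives of the components are glued to a function on \<open>N\<close>\<close>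
    define f where "f y = case_prod F (inv_into (I \<times> UNIV) e y)" for y
    have f: "f (e (i, z)) = F i z" if "i \<in> I" for i z
      using that inj by (simp add: f_def inv_into_f_f)
    have meas: "f \<in> borel_measurable N"
      using F by (subst measurable_N_iff) (auto simp: f Lp_functions_iff)
    have "Lp_energy p N f = (\<integral>\<^sup>+i. Lp_energy p (M i) (\<lambda>z. f (e (i, z))) \<partial>count_space I)"
      using meas by (rule Lp_energy_N)
    also have "\<dots> = lp_energy p I L x"
      unfolding lp_energy_def L_def using F
      by (intro nn_integral_cong) (simp add: f vnorm_Lp_powr[OF p])
    finally have "Lp_energy p N f = lp_energy p I L x" .
    then have fL: "f \<in> Lp_functions p N"
      using x meas by (simp add: Lp_functions_iff vectors_lp_sum)
    have "x = split_Lp p (Lp_class p N f)"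
    proof (rule lp_sum_eqI[OF x closed[OF fL]])
      fix i assume i: "i \<in> I"
      have "split_Lp p (Lp_class p N f) i = Lp_class p (M i) (\<lambda>z. f (e (i, z)))"
        using i by (simp add: split_Lp_class[OF fL])
      also have "(\<lambda>z. f (e (i, z))) = F i"
        by (rule ext) (rule f[OF i])
      finally show "x i = split_Lp p (Lp_class p N f) i"
        using F[OF i] by simp
    qed
    then show ?thesis by (rule image_eqI) (simp add: fL)
  qed
  ultimately show "bij_betw (split_Lp p) (vectors (Lp p N)) (vectors (lp_sum p I L))"
    using closed by (auto simp: bij_betw_def vectors_Lp)
qed

end

text \<open>
  An infinite type has room for countably many disjoint copies of itself.
\<close>

lemma ex_inj_countable_Times:
  assumes "countable I"
  shows "\<exists>e :: 'i \<times> 'o::infinite \<Rightarrow> 'o. inj_on e (I \<times> UNIV)"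
proof -
  have inf: "infinite (UNIV :: 'o set)" by (rule infinite_UNIV)
  obtain f :: "nat \<Rightarrow> 'o" where f: "inj f"
    using infinite_iff_countable_subset[THEN iffD1, OF inf] by blast
  obtain h :: "'o \<times> 'o \<Rightarrow> 'o" where h: "inj h"
    using card_of_Times_same_infinite[OF inf] unfolding card_of_ordIso[symmetric]
    by (auto simp: bij_betw_def)
  have "inj_on (\<lambda>(i, x). h (f (to_nat_on I i), x)) (I \<times> UNIV)"
    using assms by (auto intro!: inj_onI dest!: injD[OF h] injD[OF f])
  then show ?thesis by blast
qed

text \<open>
  Actions may therefore be constructed on countable \<open>\<ell>\<^sub>p\<close>-sums of \<open>L\<^sub>p\<close>-spaces; the resulting
  \<open>L\<^sub>p\<close>-space is over the same type of points as the summands.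
\<close>

lemma lp_sum_action_on_Lp:
  fixes M :: "'i \<Rightarrow> 'o::infinite measure"
  assumes "0 < p" "countable I" "group H"
    and act: "affine_isometric_action H
      (lp_sum p I (\<lambda>i. Lp p (M i) :: ('k::{real_normed_field, second_countable_topology}, ('o \<Rightarrow> 'k) set) normed_space)) \<pi> b"
  shows "\<exists>(N :: 'o measure) \<pi>' b'.
    affine_isometric_action H (Lp p N :: ('k, ('o \<Rightarrow> 'k) set) normed_space) \<pi>' b' \<and>
    (\<forall>g\<in>carrier H. vnorm (Lp p N) (b' g) = vnorm (lp_sum p I (\<lambda>i. Lp p (M i))) (b g))"
proof -
  obtain e :: "'i \<times> 'o \<Rightarrow> 'o" where "inj_on e (I \<times> UNIV)"
    using ex_inj_countable_Times[OF assms(2)] by blast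
  then interpret disjoint_union_of_measures I M e by unfold_locales
  show ?thesis
    using affine_isometric_action_transfer[OF assms(3) p_normed_space_Lp[OF assms(1)] act
        split_Lp_isometry[OF assms(1)]] by blast
qed


section \<open>Monomial representations\<close>

definition single :: "'i set \<Rightarrow> ('i \<Rightarrow> ('k::zero, 'e) normed_space) \<Rightarrow> 'i \<Rightarrow> 'e \<Rightarrow> 'i \<Rightarrow> 'e" where
  "single I L j a = (\<lambda>i\<in>I. if i = j then a else vzero (L i))"

context p_normed_family
begin

sublocale Y: p_normed_space p Y
  by (rule p_normed_space_lp_sum)

lemmas component_simps =
  p_normed_space.zero_closed[OF p_normed] p_normed_space.norm_zero[OF p_normed]
  p_normed_space.add_0_right[OF p_normed] p_normed_space.add_0_left[OF p_normed]
  p_normed_space.scale_zero[OF p_normed] p_normed_space.scale_closed[OF p_normed]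
  p_normed_space.add_closed[OF p_normed]

lemma vzero_lp_sum: "vzero Y = (\<lambda>i\<in>I. vzero (L i))"
proof -
  have "vzero Y = vscale Y 0 (vzero Y)" by simp
  also have "\<dots> = (\<lambda>i\<in>I. vzero (L i))"
    unfolding vscale_lp_sum
    by (intro restrict_ext) (simp add: p_normed_space.scale_0[OF p_normed] lp_sum_component[OF Y.zero_closed])
  finally show ?thesis .
qed

lemma single_closed [simp]:
  assumes "j \<in> I" "a \<in> vectors (L j)"
  shows "single I L j a \<in> vectors Y"
proof -
  have "lp_energy p I L (single I L j a) =
      (\<integral>\<^sup>+i. ennreal (vnorm (L j) a powr p) * indicator {j} i \<partial>count_space I)"
    unfolding lp_energy_def using p_pos
    by (intro nn_integral_cong) (auto simp: single_def indicator_def component_simps)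
  also have "\<dots> < \<infinity>"
    using assms by (subst nn_integral_indicator_singleton) auto
  finally show ?thesis
    using assms by (auto simp: vectors_lp_sum single_def component_simps)
qed

lemma vadd_single:
  "a \<in> vectors (L j) \<Longrightarrow> b \<in> vectors (L j) \<Longrightarrow>
    vadd Y (single I L j a) (single I L j b) = single I L j (vadd (L j) a b)"
  by (auto simp: vadd_lp_sum single_def component_simps)

lemma single_zero: "single I L j (vzero (L j)) = vzero Y"
  by (auto simp: vzero_lp_sum single_def)

lemma norm_add_single:
  assumes x: "x \<in> vectors Y" and j: "j \<in> I" "x j = vzero (L j)" and a: "a \<in> vectors (L j)"
  shows "vnorm Y (vadd Y x (single I L j a)) powr p = vnorm Y x powr p + vnorm (L j) a powr p"
proof -
  have "lp_energy p I L (vadd Y x (single I L j a)) =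
      (\<integral>\<^sup>+i. ennreal (vnorm (L i) (x i) powr p) + ennreal (vnorm (L j) a powr p) * indicator {j} i \<partial>count_space I)"
    unfolding lp_energy_def using x j a p_pos
    by (intro nn_integral_cong) (auto simp: vadd_lp_sum single_def indicator_def component_simps)
  also have "\<dots> = lp_energy p I L x + ennreal (vnorm (L j) a powr p)"
    unfolding lp_energy_def
    using j by (subst nn_integral_add) (auto simp: nn_integral_indicator_singleton)
  finally have "ennreal (vnorm Y (vadd Y x (single I L j a)) powr p) =
      ennreal (vnorm Y x powr p + vnorm (L j) a powr p)"
    using x j a by (simp add: vnorm_lp_sum_powr)
  then show ?thesis by (subst (asm) ennreal_inj) auto
qed

end

text \<open>
  A group that permutes the summands of an \<open>\<ell>\<^sub>p\<close>-sum by \<open>\<theta>\<close> and moves vectors between them by the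
  isometries \<open>T\<close>. Summands in one orbit are taken to be equal and \<open>T\<close> to be constant on orbits. This
  covers direct sums with permutation representations, as well as representations induced from a
  subgroup when the inducing representation extends to the whole group.
\<close>

locale monomial_representation = p_normed_family p I L + H: group H
  for p :: real and I :: "'i set" and L :: "'i \<Rightarrow> ('k::real_normed_field, 'e) normed_space"
    and H :: "'h monoid" +
  fixes \<theta> :: "'h \<Rightarrow> 'i \<Rightarrow> 'i" and T :: "'h \<Rightarrow> 'i \<Rightarrow> 'e \<Rightarrow> 'e"
  assumes \<theta>_closed [simp]: "g \<in> carrier H \<Longrightarrow> i \<in> I \<Longrightarrow> \<theta> g i \<in> I"
    and \<theta>_one [simp]: "i \<in> I \<Longrightarrow> \<theta> \<one>\<^bsub>H\<^esub> i = i"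
    and \<theta>_mult: "g \<in> carrier H \<Longrightarrow> h \<in> carrier H \<Longrightarrow> i \<in> I \<Longrightarrow> \<theta> (g \<otimes>\<^bsub>H\<^esub> h) i = \<theta> g (\<theta> h i)"
    and L_\<theta> [simp]: "g \<in> carrier H \<Longrightarrow> i \<in> I \<Longrightarrow> L (\<theta> g i) = L i"
    and T_isometry: "g \<in> carrier H \<Longrightarrow> i \<in> I \<Longrightarrow> linear_isometry (L i) (L i) (T g i)"
    and T_one [simp]: "i \<in> I \<Longrightarrow> a \<in> vectors (L i) \<Longrightarrow> T \<one>\<^bsub>H\<^esub> i a = a"
    and T_mult: "g \<in> carrier H \<Longrightarrow> h \<in> carrier H \<Longrightarrow> i \<in> I \<Longrightarrow> a \<in> vectors (L i) \<Longrightarrow>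
      T (g \<otimes>\<^bsub>H\<^esub> h) i a = T g i (T h i a)"
    and T_\<theta> [simp]: "g \<in> carrier H \<Longrightarrow> h \<in> carrier H \<Longrightarrow> i \<in> I \<Longrightarrow> T g (\<theta> h i) = T g i"
begin

definition P :: "'h \<Rightarrow> ('i \<Rightarrow> 'e) \<Rightarrow> 'i \<Rightarrow> 'e" where
  "P g x = (\<lambda>i\<in>I. T g i (x (\<theta> (inv\<^bsub>H\<^esub> g) i)))"

lemma \<theta>_inv [simp]:
  assumes "g \<in> carrier H" "i \<in> I"
  shows "\<theta> (inv\<^bsub>H\<^esub> g) (\<theta> g i) = i" "\<theta> g (\<theta> (inv\<^bsub>H\<^esub> g) i) = i"
  using assms by (simp_all flip: \<theta>_mult)

lemma component_\<theta>:
  assumes "g \<in> carrier H" "x \<in> vectors Y" "i \<in> I"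
  shows "x (\<theta> g i) \<in> vectors (L i)"
  using lp_sum_component[OF assms(2) \<theta>_closed[OF assms(1,3)]] assms by simp

lemma P_closed [simp]:
  assumes g: "g \<in> carrier H" and x: "x \<in> vectors Y"
  shows "P g x \<in> vectors Y" and norm_P: "vnorm Y (P g x) = vnorm Y x"
proof -
  have "lp_energy p I L (P g x) =
      (\<integral>\<^sup>+i. ennreal (vnorm (L (\<theta> (inv\<^bsub>H\<^esub> g) i)) (x (\<theta> (inv\<^bsub>H\<^esub> g) i)) powr p) \<partial>count_space I)"
    unfolding lp_energy_def using g x
    by (intro nn_integral_cong) (simp add: P_def linear_isometryD[OF T_isometry] component_\<theta>)
  also have "\<dots> = lp_energy p I L x"
    unfolding lp_energy_def using g
    by (intro nn_integral_bij_count_space[where f = "\<lambda>i. ennreal (vnorm (L i) (x i) powr p)"]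
        bij_betw_byWitness[where f' = "\<theta> g"]) auto
  finally have energy: "lp_energy p I L (P g x) = lp_energy p I L x" .
  then show "vnorm Y (P g x) = vnorm Y x" by (simp add: lp_sum_def)
  have "P g x \<in> (\<Pi>\<^sub>E i\<in>I. vectors (L i))"
    using g linear_isometryD(1)[OF T_isometry[OF g] component_\<theta>[OF _ x]] by (simp add: P_def)
  then show "P g x \<in> vectors Y"
    using energy x by (simp add: vectors_lp_sum)
qed

lemma P_isometry:
  assumes g: "g \<in> carrier H"
  shows "linear_isometry Y Y (P g)"
  unfolding linear_isometry_def
proof (intro conjI ballI allI)
  fix x y c assume x: "x \<in> vectors Y" and y: "y \<in> vectors Y"
  note T = linear_isometryD[OF T_isometry[OF g]]
  have xy: "x (\<theta> (inv\<^bsub>H\<^esub> g) i) \<in> vectors (L i)" "y (\<theta> (inv\<^bsub>H\<^esub> g) i) \<in> vectors (L i)" if "i \<in> I" for i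
    using g x y that by (simp_all add: component_\<theta>)
  show "P g (vadd Y x y) = vadd Y (P g x) (P g y)"
    using g xy by (auto simp: P_def vadd_lp_sum T)
  show "P g (vscale Y c x) = vscale Y c (P g x)"
    using g xy by (auto simp: P_def vscale_lp_sum T)
qed (use g in \<open>simp_all add: norm_P\<close>)

lemma P_one: "x \<in> vectors Y \<Longrightarrow> P \<one>\<^bsub>H\<^esub> x = x"
  by (rule lp_sum_eqI[of _ p I L]) (simp, assumption, simp add: P_def)

lemma P_mult:
  assumes "g \<in> carrier H" "h \<in> carrier H" "x \<in> vectors Y"
  shows "P (g \<otimes>\<^bsub>H\<^esub> h) x = P g (P h x)"
proof (rule lp_sum_eqI[of _ p I L])
  fix i assume "i \<in> I"
  then show "P (g \<otimes>\<^bsub>H\<^esub> h) x i = P g (P h x) i"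
    using assms component_\<theta>[of "inv\<^bsub>H\<^esub> h \<otimes>\<^bsub>H\<^esub> inv\<^bsub>H\<^esub> g" x i]
    by (simp add: P_def H.inv_mult_group \<theta>_mult T_mult)
qed (use assms in simp_all)

lemma P_single:
  assumes "g \<in> carrier H" "j \<in> I" "a \<in> vectors (L j)"
  shows "P g (single I L j a) = single I L (\<theta> g j) (T g j a)"
proof (rule lp_sum_eqI[of _ p I L])
  fix i assume i: "i \<in> I"
  have "T g i (vzero (L i)) = vzero (L i)"
    using i assms(1) p_normed_space.linear_isometry_zero[OF p_normed T_isometry p_normed] by blast
  moreover have "\<theta> (inv\<^bsub>H\<^esub> g) i = j \<longleftrightarrow> i = \<theta> g j"
    using assms i by auto
  ultimately show "P g (single I L j a) i = single I L (\<theta> g j) (T g j a) i"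
    using assms i by (auto simp: P_def single_def)
qed (use assms in \<open>simp_all add: linear_isometryD[OF T_isometry]\<close>)

lemma affine_isometric_action_P:
  assumes "\<And>g. g \<in> carrier H \<Longrightarrow> b g \<in> vectors Y"
    and "\<And>g h. g \<in> carrier H \<Longrightarrow> h \<in> carrier H \<Longrightarrow> b (g \<otimes>\<^bsub>H\<^esub> h) = vadd Y (P g (b h)) (b g)"
  shows "affine_isometric_action H Y (\<lambda>g. restrict (P g) (vectors Y)) b"
  using assms by (intro affine_isometric_actionI H.group_axioms P_isometry) (auto simp: P_one P_mult)

end


section \<open>Bounding a proper cocycle away from zero\<close>

lemma ex_Lp_vector:
  assumes "0 < p" "0 < c"
  shows "\<exists>a \<in> vectors (Lp p (count_space {u}) ::
    ('k::{real_normed_field, second_countable_topology}, ('o \<Rightarrow> 'k) set) normed_space).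
    vnorm (Lp p (count_space {u})) a powr p = c"
proof -
  let ?f = "\<lambda>_ :: 'o. of_real (c powr (1 / p)) :: 'k"
  have "Lp_energy p (count_space {u}) ?f = ennreal c"
    using assms by (simp add: nn_integral_count_space_finite powr_powr)
  moreover from this have f: "?f \<in> Lp_functions p (count_space {u})"
    by (simp add: Lp_functions_iff)
  ultimately have "ennreal (vnorm (Lp p (count_space {u})) (Lp_class p (count_space {u}) ?f) powr p) = ennreal c"
    using assms by (simp add: vnorm_Lp_powr)
  then have "vnorm (Lp p (count_space {u})) (Lp_class p (count_space {u}) ?f) powr p = c"
    using assms by simp
  then show ?thesis using f Lp_class_closed by blast
qed

text \<open>
  A proper cocycle may vanish at nontrivial elements, and in a graph product infinitely many words can
  be formed from such elements of different vertex groups. The remedy is to add a copy of the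
  left regular representation on \<open>\<ell>\<^sub>p(H)\<close>, with the coboundary of a multiple \<open>\<xi>\<close> of the unit vector
  at the identity: for \<open>g \<noteq> 1\<close> the vector \<open>g \<xi> - \<xi>\<close> has the value \<open>- a\<close> at the identity, and \<open>a\<close> is
  as long as desired. The index \<open>None\<close> carries the given action and \<open>Some k\<close> the coordinate
  \<open>k\<close> of \<open>\<ell>\<^sub>p(H)\<close>.
\<close>

lemma ex_proper_action_bounded_below:
  fixes M :: "'o::infinite measure" and H :: "'h monoid"
  assumes p: "0 < p" and c: "0 < c" and H: "group H"
    and act: "affine_isometric_action H
      (Lp p M :: ('k::{real_normed_field, second_countable_topology}, ('o \<Rightarrow> 'k) set) normed_space) \<pi> b"
    and proper: "proper_action H (Lp p M :: ('k, ('o \<Rightarrow> 'k) set) normed_space) \<pi> b"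
  shows "\<exists>(N :: 'o measure) \<pi>' b'.
    affine_isometric_action H (Lp p N :: ('k, ('o \<Rightarrow> 'k) set) normed_space) \<pi>' b' \<and>
    (\<forall>R. finite {g \<in> carrier H. vnorm (Lp p N) (b' g) powr p \<le> R}) \<and>
    (\<forall>g\<in>carrier H - {\<one>\<^bsub>H\<^esub>}. c \<le> vnorm (Lp p N) (b' g) powr p)"
proof -
  interpret H: group H by fact
  note D = affine_isometric_actionD[OF act]
  let ?u = "undefined :: 'o"
  define I where "I = insert None (Some ` carrier H)"
  define M' where "M' i = (case i of None \<Rightarrow> M | Some _ \<Rightarrow> count_space {?u})" for i :: "'h option"
  define L where "L i = (Lp p (M' i) :: ('k, ('o \<Rightarrow> 'k) set) normed_space)" for i
  define \<theta> where "\<theta> g = map_option (\<lambda>k. g \<otimes>\<^bsub>H\<^esub> k)" for g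
  define T where "T g i = (case i of None \<Rightarrow> \<pi> g | Some _ \<Rightarrow> \<lambda>a. a)" for g and i :: "'h option"
  have L: "L None = Lp p M" "L (Some k) = Lp p (count_space {?u})" for k
    by (simp_all add: L_def M'_def)
  interpret monomial_representation p I L H \<theta> T
  proof (intro monomial_representation.intro p_normed_family.intro monomial_representation_axioms.intro H p)
    show "p_normed_space p (L i)" if "i \<in> I" for i
      unfolding L_def by (rule p_normed_space_Lp[OF p])
    show "linear_isometry (L i) (L i) (T g i)" if "g \<in> carrier H" "i \<in> I" for g i
      using that D(1)[of g] by (cases i) (auto simp: T_def L linear_isometry_def)
    show "T \<one>\<^bsub>H\<^esub> i a = a" if "i \<in> I" "a \<in> vectors (L i)" for i a
      using that affine_isometric_action_one[OF H act] by (cases i) (auto simp: T_def L)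
    show "T (g \<otimes>\<^bsub>H\<^esub> h) i a = T g i (T h i a)"
      if "g \<in> carrier H" "h \<in> carrier H" "i \<in> I" "a \<in> vectors (L i)" for g h i a
      using that D(3) by (cases i) (auto simp: T_def L)
    show "\<theta> g i \<in> I" if "g \<in> carrier H" "i \<in> I" for g i
      using that by (auto simp: I_def \<theta>_def)
    show "\<theta> \<one>\<^bsub>H\<^esub> i = i" if "i \<in> I" for i
      using that by (auto simp: I_def \<theta>_def)
    show "\<theta> (g \<otimes>\<^bsub>H\<^esub> h) i = \<theta> g (\<theta> h i)" if "g \<in> carrier H" "h \<in> carrier H" "i \<in> I" for g h i
      using that by (auto simp: I_def \<theta>_def H.m_assoc)
    show "L (\<theta> g i) = L i" for g i
      by (cases i) (simp_all add: \<theta>_def L)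
    show "T g (\<theta> h i) = T g i" for g h i
      by (cases i) (simp_all add: \<theta>_def T_def)
  qed
  have None: "None \<in> I" and Some: "\<And>g. g \<in> carrier H \<Longrightarrow> Some g \<in> I" by (simp_all add: I_def)
  obtain a where a: "a \<in> vectors (L (Some \<one>\<^bsub>H\<^esub>))" "vnorm (L (Some \<one>\<^bsub>H\<^esub>)) a powr p = c"
    unfolding L by (rule bexE[OF ex_Lp_vector[OF p c]])
  define \<xi> where "\<xi> = single I L (Some \<one>\<^bsub>H\<^esub>) a"
  have \<xi>: "\<xi> \<in> vectors Y"
    using a by (simp add: \<xi>_def Some)
  let ?\<pi> = "\<lambda>g. restrict (P g) (vectors Y)"
  let ?b = "\<lambda>g. single I L None (b g)"
  define b' where "b' = (\<lambda>g. vadd Y (?b g) (vadd Y (?\<pi> g \<xi>) (vscale Y (- 1) \<xi>)))"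
  have "affine_isometric_action H Y ?\<pi> ?b"
  proof (rule affine_isometric_action_P)
    fix g h assume g: "g \<in> carrier H" and h: "h \<in> carrier H"
    show "?b (g \<otimes>\<^bsub>H\<^esub> h) = vadd Y (P g (?b h)) (?b g)"
      using g h D linear_isometryD[OF D(1)]
      by (simp add: P_single None L \<theta>_def T_def vadd_single)
  qed (use None D in \<open>simp add: L\<close>)
  then have act': "affine_isometric_action H Y ?\<pi> b'"
    unfolding b'_def by (rule Y.affine_isometric_action_add_coboundary[OF H _ \<xi>])
  have b': "b' g \<in> vectors Y" if "g \<in> carrier H" for g
    using affine_isometric_actionD(2)[OF act' that] .
  have "P g \<xi> = single I L (Some g) a" if "g \<in> carrier H" for g
    using that a by (simp add: \<xi>_def P_single Some \<theta>_def T_def)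
  then have comp: "b' g i = vadd (L i) (?b g i) (vadd (L i) (single I L (Some g) a i) (vscale (L i) (- 1) (\<xi> i)))"
    if "g \<in> carrier H" "i \<in> I" for g i
    using that \<xi> by (simp add: b'_def vadd_lp_sum vscale_lp_sum)
  have "b' g None = b g" if "g \<in> carrier H" for g
    unfolding comp[OF that None] using that None D(2)
    by (simp add: \<xi>_def single_def component_simps flip: L)
  then have ge_b: "vnorm (Lp p M) (b g) powr p \<le> vnorm Y (b' g) powr p" if "g \<in> carrier H" for g
    using component_powr_le[OF b'[OF that] None] that by (simp add: L)
  have "b' g (Some \<one>\<^bsub>H\<^esub>) = vscale (L (Some \<one>\<^bsub>H\<^esub>)) (- 1) a" if "g \<in> carrier H" "g \<noteq> \<one>\<^bsub>H\<^esub>" for g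
    unfolding comp[OF that(1) Some[OF H.one_closed]] using that a
    by (simp add: \<xi>_def single_def component_simps Some)
  then have ge_c: "c \<le> vnorm Y (b' g) powr p" if "g \<in> carrier H" "g \<noteq> \<one>\<^bsub>H\<^esub>" for g
    using component_powr_le[OF b'[OF that(1)], of "Some \<one>\<^bsub>H\<^esub>"] that a
    by (simp add: Some p_normed_space.norm_scale[OF p_normed])
  have fin: "finite {g \<in> carrier H. vnorm Y (b' g) powr p \<le> R}" for R
  proof (rule finite_subset)
    show "{g \<in> carrier H. vnorm Y (b' g) powr p \<le> R} \<subseteq> {g \<in> carrier H. vnorm (Lp p M) (b g) powr p \<le> R}"
      using ge_b by (fastforce intro: order_trans)
    show "finite {g \<in> carrier H. vnorm (Lp p M) (b g) powr p \<le> R}"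
      using p_normed_space.proper_action_iff[OF p_normed_space_Lp[OF p] H act] proper by blast
  qed
  have "countable I"
    using p_normed_space.proper_action_countable[OF p_normed_space_Lp[OF p] H act proper]
    by (simp add: I_def)
  from lp_sum_action_on_Lp[OF p this H act'[unfolded L_def]]
  obtain N \<pi>'' b'' where N: "affine_isometric_action H (Lp p N :: ('k, ('o \<Rightarrow> 'k) set) normed_space) \<pi>'' b''"
    "\<And>g. g \<in> carrier H \<Longrightarrow> vnorm (Lp p N) (b'' g) = vnorm Y (b' g)"
    unfolding L_def by blast
  have "finite {g \<in> carrier H. vnorm (Lp p N) (b'' g) powr p \<le> R}" for R
    using fin[of R] N(2) by (simp cong: conj_cong)
  moreover have "\<forall>g\<in>carrier H - {\<one>\<^bsub>H\<^esub>}. c \<le> vnorm (Lp p N) (b'' g) powr p"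
    using ge_c N(2) by simp
  ultimately show ?thesis using N(1) by blast
qed


section \<open>The action of the graph product\<close>

text \<open>
  Let \<open>H\<close> be the subgroup of the graph product generated by the \<open>G u\<close> with \<open>u \<in> star v\<close>. It projects
  onto \<open>G v\<close>, so it acts on \<open>X v\<close>, and the representation sought is the sum over all \<open>v\<close> of
  the representations induced from these subgroups to the graph product.

  Two retractions make this induction explicit. As \<open>component v\<close> is defined on the whole graph product,
  the inducing representation extends to it, and the induced one is the action on \<open>X v\<close>-valued
  functions on cosets with \<open>component v\<close> acting on the values. As \<open>r = restriction (star v)\<close> retracts
  onto \<open>H\<close>, the coset \<open>g H\<close> is determined by the element \<open>g r(g)\<^sup>-\<^sup>1\<close>; on such elements, \<open>h\<close>
  acts by \<open>k \<mapsto> h k r(h)\<^sup>-\<^sup>1\<close>. This formula defines an action on all group elements, in which the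
  identity has stabilizer \<open>H\<close>. All elements are admitted as indices: the orbits other than that of
  the identity only add summands on which the cocycle vanishes.
\<close>

locale graph_product_action = graph_product_of_groups V E G
  for V :: "'v set" and E :: "'v set set" and G :: "'v \<Rightarrow> 'a monoid" +
  fixes p :: real and X :: "'v \<Rightarrow> ('k::real_normed_field, 'e) normed_space"
    and \<pi> :: "'v \<Rightarrow> 'a \<Rightarrow> 'e \<Rightarrow> 'e" and \<beta> :: "'v \<Rightarrow> 'a \<Rightarrow> 'e"
  assumes p_pos: "0 < p"
    and X: "v \<in> V \<Longrightarrow> p_normed_space p (X v)"
    and action: "v \<in> V \<Longrightarrow> affine_isometric_action (G v) (X v) (\<pi> v) (\<beta> v)"
begin

abbreviation sites :: "('v \<times> ('v \<times> 'a) list set) set" where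
  "sites \<equiv> V \<times> carrier \<G>"

abbreviation space_at :: "'v \<times> ('v \<times> 'a) list set \<Rightarrow> ('k, 'e) normed_space" where
  "space_at i \<equiv> X (fst i)"

definition translate :: "('v \<times> 'a) list set \<Rightarrow> 'v \<times> ('v \<times> 'a) list set \<Rightarrow> 'v \<times> ('v \<times> 'a) list set" where
  "translate g i = (fst i, g \<otimes>\<^bsub>\<G>\<^esub> snd i \<otimes>\<^bsub>\<G>\<^esub> inv\<^bsub>\<G>\<^esub> (restriction (star (fst i)) g))"

definition twist :: "('v \<times> 'a) list set \<Rightarrow> 'v \<times> ('v \<times> 'a) list set \<Rightarrow> 'e \<Rightarrow> 'e" where
  "twist g i = \<pi> (fst i) (component (fst i) g)"

lemma restriction_closed [simp]: "g \<in> carrier \<G> \<Longrightarrow> restriction S g \<in> carrier \<G>"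
  by (rule hom_in_carrier[OF restriction_hom])

lemma component_closed [simp]: "v \<in> V \<Longrightarrow> g \<in> carrier \<G> \<Longrightarrow> component v g \<in> carrier (G v)"
  by (rule hom_in_carrier[OF component_hom])

lemma component_one [simp]: "v \<in> V \<Longrightarrow> component v \<one>\<^bsub>\<G>\<^esub> = \<one>\<^bsub>G v\<^esub>"
  by (rule hom_one[OF component_hom \<G>.group_axioms groups])

lemma restriction_one [simp]: "restriction S \<one>\<^bsub>\<G>\<^esub> = \<one>\<^bsub>\<G>\<^esub>"
  by (rule hom_one[OF restriction_hom \<G>.group_axioms \<G>.group_axioms])

lemmas restriction_mult = hom_mult[OF restriction_hom]

sublocale monomial_representation p sites space_at \<G> translate twist
proof (intro monomial_representation.intro p_normed_family.intro monomial_representation_axioms.intro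
    \<G>.group_axioms p_pos)
  fix g h i a assume i: "i \<in> sites"
  then have v: "fst i \<in> V" by auto
  note D = affine_isometric_actionD[OF action[OF v]]
  show "p_normed_space p (space_at i)" by (rule X[OF v])
  show "translate \<one>\<^bsub>\<G>\<^esub> i = i"
    using i by (auto simp: translate_def)
  show "twist \<one>\<^bsub>\<G>\<^esub> i a = a" if "a \<in> vectors (space_at i)"
    using that v by (simp add: twist_def affine_isometric_action_one[OF groups action])
  assume g: "g \<in> carrier \<G>"
  show "translate g i \<in> sites"
    using i g by (auto simp: translate_def)
  show "space_at (translate g i) = space_at i"
    by (simp add: translate_def)
  show "linear_isometry (space_at i) (space_at i) (twist g i)"
    unfolding twist_def using v g by (intro D component_closed)
  assume h: "h \<in> carrier \<G>"
  show "translate (g \<otimes>\<^bsub>\<G>\<^esub> h) i = translate g (translate h i)"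
    using i g h by (auto simp: translate_def restriction_mult \<G>.inv_mult_group \<G>.m_assoc)
  show "twist g (translate h i) = twist g i"
    by (simp add: twist_def translate_def)
  show "twist (g \<otimes>\<^bsub>\<G>\<^esub> h) i a = twist g i (twist h i a)" if "a \<in> vectors (space_at i)"
    using that v g h hom_mult[OF component_hom[OF v] g h] by (simp add: twist_def D)
qed

lemma \<beta>_closed [simp]: "v \<in> V \<Longrightarrow> s \<in> carrier (G v) \<Longrightarrow> \<beta> v s \<in> vectors (X v)"
  using affine_isometric_actionD(2)[OF action] .

lemma \<beta>_one: "v \<in> V \<Longrightarrow> \<beta> v \<one>\<^bsub>G v\<^esub> = vzero (X v)"
proof -
  assume v: "v \<in> V"
  interpret v: group "G v" by (rule groups[OF v])
  have "\<beta> v \<one>\<^bsub>G v\<^esub> = vadd (X v) (\<beta> v \<one>\<^bsub>G v\<^esub>) (\<beta> v \<one>\<^bsub>G v\<^esub>)"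
    using affine_isometric_actionD(4)[OF action[OF v] v.one_closed v.one_closed]
      affine_isometric_action_one[OF groups action, OF v v] v by simp
  then show ?thesis
    using v by (intro p_normed_space.add_eq_self[OF X[OF v]]) auto
qed

abbreviation base :: "'v \<Rightarrow> 'v \<times> ('v \<times> 'a) list set" where
  "base v \<equiv> (v, \<one>\<^bsub>\<G>\<^esub>)"

abbreviation place :: "'v \<Rightarrow> 'a \<Rightarrow> 'v \<times> ('v \<times> 'a) list set \<Rightarrow> 'e" where
  "place v s \<equiv> single sites space_at (base v) (\<beta> v s)"

text \<open>
  The stabilizer of a base site is the subgroup of the star, given as the set of fixed points of the
  retraction.
\<close>

lemma base_fixed_iff:
  assumes "g \<in> carrier \<G>"
  shows "translate g (base v) = base v \<longleftrightarrow> restriction (star v) g = g"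
proof -
  have "translate g (base v) = base v \<longleftrightarrow> g \<otimes>\<^bsub>\<G>\<^esub> inv\<^bsub>\<G>\<^esub> (restriction (star v) g) = \<one>\<^bsub>\<G>\<^esub>"
    using assms by (simp add: translate_def)
  also have "\<dots> \<longleftrightarrow> g = restriction (star v) g"
    using assms \<G>.inv_solve_right'[of "\<one>\<^bsub>\<G>\<^esub>" g "restriction (star v) g"] by simp
  finally show ?thesis by (simp only: eq_commute)
qed

lemma base_fixed_by_star:
  assumes "u \<in> star v" "u \<in> V" "s \<in> carrier (G u)"
  shows "translate (cls [(u, s)]) (base v) = base v"
  using assms by (simp add: base_fixed_iff restriction_cls)

text \<open>
  Each vertex group acts by affine maps, with its own cocycle placed at its base site. The base site of
  \<open>v\<close> is fixed by the adjacent vertex groups, which act trivially on the vectors placed there; so the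
  affine actions of adjacent vertex groups commute and define an action of the graph product.
\<close>

definition letter_action :: "'v \<Rightarrow> 'a \<Rightarrow> ('v \<times> ('v \<times> 'a) list set \<Rightarrow> 'e) \<Rightarrow> 'v \<times> ('v \<times> 'a) list set \<Rightarrow> 'e" where
  "letter_action v s y = vadd Y (P (cls [(v, s)]) y) (place v s)"

definition word_action :: "('v \<times> 'a) list \<Rightarrow> ('v \<times> ('v \<times> 'a) list set \<Rightarrow> 'e) \<Rightarrow> 'v \<times> ('v \<times> 'a) list set \<Rightarrow> 'e" where
  "word_action w y = foldr (\<lambda>(v, s). letter_action v s) w y"

lemma word_action_simps [simp]:
  "word_action [] y = y"
  "word_action ((v, s) # w) y = letter_action v s (word_action w y)"
  "word_action (x @ w) y = word_action x (word_action w y)"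
  by (simp_all add: word_action_def)

lemma letter_action_closed [simp]:
  "v \<in> V \<Longrightarrow> s \<in> carrier (G v) \<Longrightarrow> y \<in> vectors Y \<Longrightarrow> letter_action v s y \<in> vectors Y"
  by (simp add: letter_action_def)

lemma word_action_closed [simp]: "w \<in> words \<Longrightarrow> y \<in> vectors Y \<Longrightarrow> word_action w y \<in> vectors Y"
  by (induction w) auto

lemma P_place_same:
  assumes "v \<in> V" "s \<in> carrier (G v)" "t \<in> carrier (G v)"
  shows "P (cls [(v, s)]) (place v t) = single sites space_at (base v) (\<pi> v s (\<beta> v t))"
  using assms by (simp add: P_single base_fixed_by_star star_def twist_def component_letter)

lemma P_place_adjacent:
  assumes "{v, u} \<in> E" "s \<in> carrier (G v)" "t \<in> carrier (G u)"
  shows "P (cls [(v, s)]) (place u t) = place u t"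
proof -
  note e = edgeD[OF assms(1)]
  have "v \<in> star u" using assms(1) by (simp add: star_def insert_commute)
  moreover have "twist (cls [(v, s)]) (base u) (\<beta> u t) = \<beta> u t"
    using assms e by (simp add: twist_def component_letter affine_isometric_action_one[OF groups action])
  ultimately show ?thesis
    using assms e by (simp add: P_single base_fixed_by_star)
qed

lemma word_action_cong:
  assumes "w \<sim> w'" "y \<in> vectors Y"
  shows "word_action w y = word_action w' y"
  unfolding word_action_def
proof (rule syllable_action_cong[OF _ _ _ _ assms])
  show "letter_action v \<one>\<^bsub>G v\<^esub> y = y" if "v \<in> V" "y \<in> vectors Y" for v y
    using that by (simp add: letter_action_def cls_unit \<beta>_one P_one)
      (metis Y.add_0_right fst_conv single_zero)
next
  fix v g h y assume v: "v \<in> V" and gh: "g \<in> carrier (G v)" "h \<in> carrier (G v)" and y: "y \<in> vectors Y"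
  interpret v: group "G v" by (rule groups[OF v])
  note lin = linear_isometryD[OF P_isometry]
  note act = affine_isometric_actionD[OF action[OF v]]
  have "place v (g \<otimes>\<^bsub>G v\<^esub> h) = vadd Y (P (cls [(v, g)]) (place v h)) (place v g)"
    using v gh act linear_isometryD(1)[OF act(1)] by (simp add: P_place_same vadd_single)
  then show "letter_action v (g \<otimes>\<^bsub>G v\<^esub> h) y = letter_action v g (letter_action v h y)"
    using v gh y by (simp add: letter_action_def cls_mult P_mult lin Y.add_assoc)
next
  fix v u g h y
  assume e: "{v, u} \<in> E" and gh: "g \<in> carrier (G v)" "h \<in> carrier (G u)" and y: "y \<in> vectors Y"
  note e' = edgeD[OF e]
  note lin = linear_isometryD[OF P_isometry]
  let ?g = "cls [(v, g)]" and ?h = "cls [(u, h)]"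
  have mem: "?g \<in> carrier \<G>" "?h \<in> carrier \<G>" "place v g \<in> vectors Y" "place u h \<in> vectors Y"
    using e' gh by simp_all
  have "?g \<otimes>\<^bsub>\<G>\<^esub> ?h = ?h \<otimes>\<^bsub>\<G>\<^esub> ?g"
    using cls_commute[OF e gh] cls_append[of "[(v, g)]" "[(u, h)]"] cls_append[of "[(u, h)]" "[(v, g)]"]
      e' gh by simp
  then have "P ?g (P ?h y) = P ?h (P ?g y)"
    using mem y by (simp flip: P_mult)
  moreover have "P ?g (place u h) = place u h" "P ?h (place v g) = place v g"
    using P_place_adjacent[of v u] P_place_adjacent[of u v] e gh by (simp_all add: insert_commute)
  ultimately show "letter_action v g (letter_action u h y) = letter_action u h (letter_action v g y)"
    unfolding letter_action_def using mem y
    by (simp add: lin Y.add_assoc Y.add_comm[of "place v g"])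
qed auto

definition cocycle :: "('v \<times> 'a) list set \<Rightarrow> 'v \<times> ('v \<times> 'a) list set \<Rightarrow> 'e" where
  "cocycle g = word_action (SOME w. w \<in> words \<and> cls w = g) (vzero Y)"

lemma cocycle_cls:
  assumes "w \<in> words"
  shows "cocycle (cls w) = word_action w (vzero Y)"
proof -
  let ?w = "SOME x. x \<in> words \<and> cls x = cls w"
  have "?w \<in> words \<and> cls ?w = cls w"
    by (rule someI[of _ w]) (use assms in simp)
  then have "?w \<sim> w" using cls_eq_iff assms by blast
  then show ?thesis
    unfolding cocycle_def by (rule word_action_cong) simp
qed

lemma word_action_affine:
  assumes "w \<in> words" "y \<in> vectors Y"
  shows "word_action w y = vadd Y (P (cls w) y) (word_action w (vzero Y))"
  using assms(1)
proof (induction w)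
  case Nil
  then show ?case using assms by (simp add: cls_Nil P_one)
next
  case (Cons a w)
  obtain v s where a: "a = (v, s)" by fastforce
  have mem: "v \<in> V" "s \<in> carrier (G v)" "w \<in> words" using Cons.prems a by auto
  note lin = linear_isometryD[OF P_isometry]
  show ?case
    using mem assms(2) Cons.IH
    by (simp add: a letter_action_def cls_Cons[of v s w] P_mult lin Y.add_assoc)
qed

lemma affine_isometric_action_cocycle:
  "affine_isometric_action \<G> Y (\<lambda>g. restrict (P g) (vectors Y)) cocycle"
proof (rule affine_isometric_action_P)
  show "cocycle g \<in> vectors Y" if "g \<in> carrier \<G>" for g
  proof -
    obtain w where "w \<in> words" "g = cls w"
      using \<open>g \<in> carrier \<G>\<close> by (auto simp: carrier_graph_product)
    then show ?thesis by (simp add: cocycle_cls)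
  qed
  fix g h assume "g \<in> carrier \<G>" "h \<in> carrier \<G>"
  then obtain x y where "x \<in> words" "g = cls x" "y \<in> words" "h = cls y"
    by (auto simp: carrier_graph_product)
  then show "cocycle (g \<otimes>\<^bsub>\<G>\<^esub> h) = vadd Y (P g (cocycle h)) (cocycle g)"
    using word_action_affine[of x "word_action y (vzero Y)"]
    by (simp add: cocycle_cls flip: cls_append)
qed

text \<open>
  The cocycle of \<open>s\<^sub>1 \<dots> s\<^sub>n\<close> is the sum of the vectors placed at the base sites of the letters, each
  translated by the prefix that precedes its letter.
\<close>

lemma word_action_support:
  assumes "w \<in> words" "i \<in> sites" "word_action w (vzero Y) i \<noteq> vzero (space_at i)"
  shows "\<exists>x s y. w = x @ (fst i, s) # y \<and> i = translate (cls x) (base (fst i))"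
  using assms
proof (induction w arbitrary: i)
  case Nil
  then show ?case by (simp add: vzero_lp_sum)
next
  case (Cons a w)
  obtain v s where a: "a = (v, s)" by fastforce
  have mem: "v \<in> V" "s \<in> carrier (G v)" "w \<in> words" using Cons.prems a by auto
  let ?g = "cls [(v, s)]" and ?B = "word_action w (vzero Y)"
  have g: "?g \<in> carrier \<G>" using mem by simp
  show ?case
  proof (cases "i = base v")
    case True
    then have "a # w = [] @ (fst i, s) # w \<and> i = translate (cls []) (base (fst i))"
      using a mem by (simp add: cls_Nil)
    then show ?thesis by blast
  next
    case False
    \<comment> \<open>the value at \<open>i\<close> comes from the value of the shorter word at \<open>?j\<close>\<close>
    let ?j = "translate (inv\<^bsub>\<G>\<^esub> ?g) i"
    have j: "?j \<in> sites" "fst ?j = fst i" "translate ?g ?j = i"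
      using g Cons.prems(2) by (simp_all, simp add: translate_def)
    have "?B ?j \<noteq> vzero (space_at i)"
    proof
      assume zero: "?B ?j = vzero (space_at i)"
      have "twist ?g i (vzero (space_at i)) = vzero (space_at i)"
        using g Cons.prems(2) p_normed_space.linear_isometry_zero[OF p_normed T_isometry p_normed] by blast
      then have "letter_action v s ?B i = vzero (space_at i)"
        using False Cons.prems(2) zero
        by (simp add: letter_action_def vadd_lp_sum single_def P_def component_simps)
      then show False using Cons.prems(3) a by simp
    qed
    then obtain x t y where w: "w = x @ (fst ?j, t) # y" "?j = translate (cls x) (base (fst ?j))"
      using Cons.IH[OF mem(3) j(1)] j(2) by metis
    have x: "x \<in> words" and v: "fst i \<in> V" using mem w Cons.prems(2) by auto
    have "i = translate ?g (translate (cls x) (base (fst i)))"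
      using j w by metis
    also have "\<dots> = translate (cls ((v, s) # x)) (base (fst i))"
      using mem x v by (simp add: cls_Cons[of v s x] \<theta>_mult)
    finally have "a # w = ((v, s) # x) @ (fst i, t) # y \<and> i = translate (cls ((v, s) # x)) (base (fst i))"
      using w a j by simp
    then show ?thesis by blast
  qed
qed

text \<open>
  For a geodesic word, the sites of different letters are different, by \<open>geodesic_separates\<close>.
  Hence the \<open>p\<close>-th powers of the norms add up.
\<close>

lemma norm_word_action:
  assumes "geodesic w"
  shows "vnorm Y (word_action w (vzero Y)) powr p = (\<Sum>(v, s)\<leftarrow>w. vnorm (X v) (\<beta> v s) powr p)"
  using assms
proof (induction w)
  case Nil
  then show ?case using p_pos by simp
next
  case (Cons a w)
  obtain v s where a: "a = (v, s)" by fastforce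
  have mem: "v \<in> V" "s \<in> carrier (G v)" "w \<in> words"
    using geodesic_words[OF Cons.prems] a by auto
  have geo: "geodesic w" using geodesic_subword[of "[a]" w "[]"] Cons.prems by simp
  let ?g = "cls [(v, s)]" and ?B = "word_action w (vzero Y)"
  have g: "?g \<in> carrier \<G>" and base: "base v \<in> sites" using mem by simp_all
  \<comment> \<open>no letter of \<open>w\<close> contributes at the base site of \<open>v\<close>, and the new letter fixes this site\<close>
  have "?B (base v) = vzero (X v)"
  proof (rule ccontr)
    assume "?B (base v) \<noteq> vzero (X v)"
    then obtain x t y where "w = x @ (v, t) # y" "base v = translate (cls x) (base v)"
      using word_action_support[OF mem(3) base] by auto
    moreover from this have "x \<in> words" using mem by auto
    ultimately show False
      using geodesic_separates[of v s x t y] Cons.prems a base_fixed_iff[of "cls x" v] by simp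
  qed
  moreover have "translate (inv\<^bsub>\<G>\<^esub> ?g) (base v) = base v"
    using \<theta>_inv(1)[OF g base] mem by (simp add: base_fixed_by_star star_def)
  moreover have "twist ?g (base v) (vzero (X v)) = vzero (X v)"
    using T_isometry[OF g base] X[OF mem(1)]
    by (intro p_normed_space.linear_isometry_zero) auto
  ultimately have "P ?g ?B (base v) = vzero (X v)"
    using base by (simp add: P_def)
  then have "vnorm Y (letter_action v s ?B) powr p = vnorm Y (P ?g ?B) powr p + vnorm (X v) (\<beta> v s) powr p"
    unfolding letter_action_def using mem base norm_add_single[of "P ?g ?B" "base v" "\<beta> v s"] by simp
  also have "\<dots> = vnorm Y ?B powr p + vnorm (X v) (\<beta> v s) powr p"
    using mem by (simp add: norm_P)
  finally show ?case using Cons.IH[OF geo] a by simp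
qed

text \<open>
  A bound on the cocycle bounds the number of letters of a geodesic word, since each contributes at
  least \<open>1\<close>, and leaves finitely many vertices and then finitely many letters to choose from.
\<close>

lemma finite_cocycle_bounded:
  fixes c :: "'v \<Rightarrow> real"
  assumes fin_s: "\<And>v R. v \<in> V \<Longrightarrow> finite {s \<in> carrier (G v). vnorm (X v) (\<beta> v s) powr p \<le> R}"
    and below: "\<And>v s. v \<in> V \<Longrightarrow> s \<in> carrier (G v) \<Longrightarrow> s \<noteq> \<one>\<^bsub>G v\<^esub> \<Longrightarrow> c v \<le> vnorm (X v) (\<beta> v s) powr p"
    and c: "\<And>v. v \<in> V \<Longrightarrow> 1 \<le> c v" and fin_v: "\<And>R. finite {v \<in> V. c v \<le> R}"
  shows "finite {g \<in> carrier \<G>. vnorm Y (cocycle g) powr p \<le> R}"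
proof -
  define A where "A = (SIGMA v:{v \<in> V. c v \<le> R}. {s \<in> carrier (G v). vnorm (X v) (\<beta> v s) powr p \<le> R})"
  define W where "W = {w. set w \<subseteq> A \<and> length w \<le> nat \<lfloor>R\<rfloor>}"
  have "finite W"
    unfolding W_def A_def by (intro finite_lists_length_le finite_SigmaI fin_s fin_v) auto
  moreover have "{g \<in> carrier \<G>. vnorm Y (cocycle g) powr p \<le> R} \<subseteq> cls ` W"
  proof
    fix g assume g: "g \<in> {g \<in> carrier \<G>. vnorm Y (cocycle g) powr p \<le> R}"
    then obtain w where w: "geodesic w" "cls w = g"
      using ex_geodesic by blast
    define f where "f = (\<lambda>(v, s). vnorm (X v) (\<beta> v s) powr p)"
    have sum: "sum_list (map f w) \<le> R"
      using g w norm_word_action[OF w(1)] by (auto simp: cocycle_cls geodesic_words f_def)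
    have nonneg: "0 \<le> x" if "x \<in> set (map f w)" for x
      using that by (auto simp: f_def)
    have letter: "v \<in> V \<and> s \<in> carrier (G v) \<and> c v \<le> f (v, s)" if "(v, s) \<in> set w" for v s
    proof -
      have "v \<in> V" "s \<in> carrier (G v)"
        using that geodesic_words[OF w(1)] by (auto simp: syllable_words_def)
      then show ?thesis
        using below geodesic_letter_nontrivial[OF w(1) that] by (simp add: f_def)
    qed
    have "f a \<le> R" if "a \<in> set w" for a
      using member_le_sum_list[of "f a" "map f w"] nonneg that sum by force
    then have "set w \<subseteq> A"
      using letter unfolding A_def f_def by fastforce
    moreover have "real (length w) \<le> sum_list (map f w)"
    proof -
      have "sum_list (map (\<lambda>_. 1) w) \<le> sum_list (map f w)"
        using letter c by (intro sum_list_mono) (fastforce intro: order_trans)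
      then show ?thesis by (simp add: sum_list_triv)
    qed
    then have "length w \<le> nat \<lfloor>R\<rfloor>" using sum by linarith
    ultimately show "g \<in> cls ` W" using w by (auto simp: W_def)
  qed
  ultimately show ?thesis by (rule finite_surj)
qed

end


section \<open>Restriction to the vertex groups, and the equivalence\<close>

lemma admits_proper_Lp_action_subgroup:
  assumes inj: "inj_on f (carrier K)" and f: "f \<in> hom K H"
    and H: "admits_proper_Lp_action TYPE('o::infinite)
      TYPE('k::{real_normed_field, second_countable_topology}) p H"
  shows "admits_proper_Lp_action TYPE('o) TYPE('k) p K"
proof -
  obtain M :: "'o measure" and \<pi> b
    where act: "affine_isometric_action H (Lp p M :: ('k, ('o \<Rightarrow> 'k) set) normed_space) \<pi> b"
      and proper: "proper_action H (Lp p M :: ('k, ('o \<Rightarrow> 'k) set) normed_space) \<pi> b"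
    using H unfolding admits_proper_Lp_action_def by blast
  have closed: "f k \<in> carrier H" if "k \<in> carrier K" for k
    using f that by (rule hom_in_carrier)
  have "affine_isometric_action K (Lp p M :: ('k, ('o \<Rightarrow> 'k) set) normed_space) (\<pi> \<circ> f) (b \<circ> f)"
    using act f hom_compose[OF f, of \<pi>]
    by (auto simp: affine_isometric_action_def closed hom_mult Pi_iff)
  moreover have "proper_action K (Lp p M :: ('k, ('o \<Rightarrow> 'k) set) normed_space) (\<pi> \<circ> f) (b \<circ> f)"
    unfolding proper_action_def
  proof (intro allI impI ballI)
    fix R :: real and x assume "0 < R" "x \<in> vectors (Lp p M :: ('k, ('o \<Rightarrow> 'k) set) normed_space)"
    then obtain F where F: "finite F" "\<forall>g\<in>carrier H - F. R < vnorm (Lp p M) (vadd (Lp p M) (\<pi> g x) (b g))"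
      using proper unfolding proper_action_def by metis
    have "finite (f -` F \<inter> carrier K)"
      using finite_vimage_IntI[OF F(1) inj] .
    then show "\<exists>F. finite F \<and> F \<subseteq> carrier K \<and>
        (\<forall>g\<in>carrier K - F. R < vnorm (Lp p M) (vadd (Lp p M) ((\<pi> \<circ> f) g x) ((b \<circ> f) g)))"
      using F(2) closed by (intro exI[of _ "f -` F \<inter> carrier K"]) auto
  qed
  ultimately show ?thesis unfolding admits_proper_Lp_action_def by blast
qed

text \<open>
  The vertex groups are countable because they act properly, so the sum is countable and can be
  realized as an \<open>L\<^sub>p\<close>-space. The lower bound \<open>c v\<close> on the cocycle of \<open>G v\<close> grows along an
  enumeration of \<open>V\<close>, which makes the action proper when there are infinitely many vertices.
\<close>

lemma admits_proper_Lp_action_graph_product: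
  fixes p :: real and V :: "'v set" and E :: "'v set set" and G :: "'v \<Rightarrow> 'a monoid"
  assumes p: "0 < p" and simplicial: "simplicial_graph V E" and V: "countable V"
    and G: "\<And>v. v \<in> V \<Longrightarrow> group (G v)"
    and actions: "\<And>v. v \<in> V \<Longrightarrow> admits_proper_Lp_action TYPE('o::infinite)
      TYPE('k::{real_normed_field, second_countable_topology}) p (G v)"
  shows "admits_proper_Lp_action TYPE('o) TYPE('k) p (graph_product V E G)"
proof -
  interpret graph_product_of_groups V E G by (rule graph_product_of_groups.intro) fact+
  note Lp = p_normed_space_Lp[OF p, where 'k = 'k]
  define c where "c v = real (Suc (to_nat_on V v))" for v
  have "countable (carrier (G v))" if "v \<in> V" for v
    using actions[OF that] p_normed_space.proper_action_countable[OF Lp G[OF that]]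
    unfolding admits_proper_Lp_action_def by blast
  then have "countable words"
    using V unfolding syllable_words_def by (intro countable_lists countable_SIGMA) auto
  then have countable: "countable (V \<times> carrier \<G>)"
    using V by (simp add: carrier_graph_product)
  have fin_c: "finite {v \<in> V. c v \<le> R}" for R
  proof (rule finite_imageD)
    have "to_nat_on V ` {v \<in> V. c v \<le> R} \<subseteq> {..nat \<lfloor>R\<rfloor>}"
      by (auto simp: c_def) linarith
    then show "finite (to_nat_on V ` {v \<in> V. c v \<le> R})"
      by (rule finite_subset) simp
    show "inj_on (to_nat_on V) {v \<in> V. c v \<le> R}"
      using inj_on_to_nat_on[OF V] by (rule inj_on_subset) auto
  qed
  define Q where "Q v N \<pi> b \<longleftrightarrow>
      affine_isometric_action (G v) (Lp p N :: ('k, ('o \<Rightarrow> 'k) set) normed_space) \<pi> b \<and>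
      (\<forall>R. finite {g \<in> carrier (G v). vnorm (Lp p N) (b g) powr p \<le> R}) \<and>
      (\<forall>g\<in>carrier (G v) - {\<one>\<^bsub>G v\<^esub>}. c v \<le> vnorm (Lp p N) (b g) powr p)"
    for v and N :: "'o measure" and \<pi> b
  have "\<exists>N \<pi> b. Q v N \<pi> b" if v: "v \<in> V" for v
    using actions[OF v] ex_proper_action_bounded_below[OF p _ G[OF v], of "c v"]
    unfolding admits_proper_Lp_action_def Q_def by (auto simp: c_def)
  then obtain N \<pi> \<beta> where Q: "\<And>v. v \<in> V \<Longrightarrow> Q v (N v) (\<pi> v) (\<beta> v)"
    by metis
  have act: "affine_isometric_action (G v) (Lp p (N v) :: ('k, ('o \<Rightarrow> 'k) set) normed_space) (\<pi> v) (\<beta> v)"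
    and fin: "\<And>R. finite {g \<in> carrier (G v). vnorm (Lp p (N v)) (\<beta> v g) powr p \<le> R}"
    and below: "\<And>g. g \<in> carrier (G v) \<Longrightarrow> g \<noteq> \<one>\<^bsub>G v\<^esub> \<Longrightarrow> c v \<le> vnorm (Lp p (N v)) (\<beta> v g) powr p"
    if "v \<in> V" for v
    using Q[OF that] unfolding Q_def by simp_all
  interpret graph_product_action V E G p "\<lambda>v. Lp p (N v) :: ('k, ('o \<Rightarrow> 'k) set) normed_space" \<pi> \<beta>
    by (intro graph_product_action.intro graph_product_action_axioms.intro
        graph_product_of_groups_axioms Lp act p)
  have fin_b: "finite {g \<in> carrier \<G>. vnorm Y (cocycle g) powr p \<le> R}" for R
    using fin below fin_c by (intro finite_cocycle_bounded[where c = c]) (auto simp: c_def)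
  obtain N' :: "'o measure" and \<pi>' b' where
    act': "affine_isometric_action \<G> (Lp p N' :: ('k, ('o \<Rightarrow> 'k) set) normed_space) \<pi>' b'"
    and norm: "\<And>g. g \<in> carrier \<G> \<Longrightarrow> vnorm (Lp p N' :: ('k, ('o \<Rightarrow> 'k) set) normed_space) (b' g) = vnorm Y (cocycle g)"
    using lp_sum_action_on_Lp[OF p countable \<G>.group_axioms affine_isometric_action_cocycle] by blast
  have "finite {g \<in> carrier \<G>. vnorm (Lp p N' :: ('k, ('o \<Rightarrow> 'k) set) normed_space) (b' g) powr p \<le> R}" for R
    using fin_b[of R] norm by (simp cong: conj_cong)
  then have "proper_action \<G> (Lp p N' :: ('k, ('o \<Rightarrow> 'k) set) normed_space) \<pi>' b'"
    using p_normed_space.proper_action_iff[OF Lp \<G>.group_axioms act'] by blast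
  then show ?thesis
    using act' unfolding admits_proper_Lp_action_def by blast
qed

theorem theorem3p5:
  fixes p :: real and V :: "'v set" and E :: "'v set set" and G :: "'v \<Rightarrow> 'a monoid"
  assumes "p \<ge> 1"
    and "simplicial_graph V E"
    and "countable V"
    and "\<And>v. v \<in> V \<Longrightarrow> group (G v)"
  shows "admits_proper_Lp_action TYPE('o::infinite)
      TYPE('k::{real_normed_field, second_countable_topology}) p (graph_product V E G) \<longleftrightarrow>
    (\<forall>v\<in>V. admits_proper_Lp_action TYPE('o) TYPE('k) p (G v))"
proof
  assume "\<forall>v\<in>V. admits_proper_Lp_action TYPE('o) TYPE('k) p (G v)"
  then show "admits_proper_Lp_action TYPE('o) TYPE('k) p (graph_product V E G)"
    using assms by (intro admits_proper_Lp_action_graph_product) auto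
next
  interpret graph_product_of_groups V E G
    by (rule graph_product_of_groups.intro) (rule assms(2), rule assms(4))
  assume "admits_proper_Lp_action TYPE('o) TYPE('k) p (graph_product V E G)"
  then show "\<forall>v\<in>V. admits_proper_Lp_action TYPE('o) TYPE('k) p (G v)"
    using admits_proper_Lp_action_subgroup[OF inj_on_letter letter_hom] by blast
qed

end
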